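(* Let $\beta:\mathbb{R}^3\to\mathbb{R}^3$ be a smooth shift vector field with bounded vorticity $\omega=\nabla\times\beta$, and consider the flat-slice unit-lapse spacetime metric $$ds^2=-dt^2+\delta_{ij}(dx^i+\beta^i\,dt)(dx^j+\beta^j\,dt)$$ with Eulerian momentum density $j$. Then $$j\equiv0\iff\beta=\nabla\phi+\Omega\times\mathbf{x}\quad\text{for a scalar function }\phi\text{ on }\mathbb{R}^3\text{ and a constant vector }\Omega\in\mathbb{R}^3.$$ Moreover, the rotation term $\beta=\Omega\times\mathbf{x}$ gives $K_{ij}=0$, hence $G_{ab}=0$, identically.
   Context: Flat unit-lapse slice: lapse $\alpha=1$, spatial metric $\gamma_{ij}=\delta_{ij}$, shift $\beta_i=g_{0i}$ independent of $t$ (static). Signature $(-+++)$, units $G=c=1$. $n^a=\partial_t-\beta^i\partial_i$ is the unit normal of the slices $t=\text{const}$, $h^a{}_b=\delta^a{}_b+n^an_b$. $G_{ab}=R_{ab}-\tfrac12Rg_{ab}$ is the Einstein tensor of the metric, and the stress-energy is defined by $T_{ab}=G_{ab}/8\pi$. The Eulerian momentum density is $j^i=-h^i{}_aT^a{}_bn^b$. The extrinsic curvature of the slice is $K_{ij}=-\tfrac12(\partial_i\beta_j+\partial_j\beta_i)$. $\nabla$ and $\nabla\times$ are the Euclidean gradient and curl on $\mathbb{R}^3$. *)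

theory Defs
  imports "HOL-Analysis.Analysis"
begin

section \<open>Partial derivatives, smoothness, curl\<close>

definition partial :: "'n::finite \<Rightarrow> (real^'n \<Rightarrow> 'b::real_normed_vector) \<Rightarrow> real^'n \<Rightarrow> 'b" where
  "partial i f x = frechet_derivative f (at x) (axis i 1)"

text \<open>All iterated partial derivatives are differentiable everywhere. Since differentiable functions
  are continuous and functions with continuous partial derivatives are differentiable, this is
  \<open>C\<^sup>\<infinity>\<close> on the whole space.\<close>

definition smooth :: "(real^'n::finite \<Rightarrow> 'b::real_normed_vector) \<Rightarrow> bool" where
  "smooth f \<longleftrightarrow> (\<forall>is x. foldr partial is f differentiable (at x))"

definition curl :: "(real^3 \<Rightarrow> real^3) \<Rightarrow> real^3 \<Rightarrow> real^3" where
  "curl v x = vector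
     [partial 2 (\<lambda>y. v y $ 3) x - partial 3 (\<lambda>y. v y $ 2) x,
      partial 3 (\<lambda>y. v y $ 1) x - partial 1 (\<lambda>y. v y $ 3) x,
      partial 1 (\<lambda>y. v y $ 2) x - partial 2 (\<lambda>y. v y $ 1) x]"

section \<open>Curvature of a metric in global coordinates\<close>

text \<open>A metric is given by its covariant components \<open>g p $ a $ b\<close> as functions of the coordinates.\<close>

type_synonym 'n metric = "real^'n \<Rightarrow> real^'n^'n"

definition inverse_metric :: "'n::finite metric \<Rightarrow> real^'n \<Rightarrow> real^'n^'n" where
  "inverse_metric g p = matrix_inv (g p)"

text \<open>\<open>christoffel g a b c p\<close> is \<open>\<Gamma>\<^sup>a\<^sub>b\<^sub>c\<close> and \<open>riemann g a b c d p\<close> is \<open>R\<^sup>a\<^sub>b\<^sub>c\<^sub>d\<close>, with the sign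
  convention in which round spheres have positive Ricci curvature.\<close>

definition christoffel :: "'n::finite metric \<Rightarrow> 'n \<Rightarrow> 'n \<Rightarrow> 'n \<Rightarrow> real^'n \<Rightarrow> real" where
  "christoffel g a b c p = 1/2 * (\<Sum>d\<in>UNIV. inverse_metric g p $ a $ d *
     (partial b (\<lambda>q. g q $ d $ c) p + partial c (\<lambda>q. g q $ d $ b) p - partial d (\<lambda>q. g q $ b $ c) p))"

definition riemann :: "'n::finite metric \<Rightarrow> 'n \<Rightarrow> 'n \<Rightarrow> 'n \<Rightarrow> 'n \<Rightarrow> real^'n \<Rightarrow> real" where
  "riemann g a b c d p =
     partial c (christoffel g a d b) p - partial d (christoffel g a c b) p
     + (\<Sum>e\<in>UNIV. christoffel g a c e p * christoffel g e d b p)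
     - (\<Sum>e\<in>UNIV. christoffel g a d e p * christoffel g e c b p)"

definition ricci :: "'n::finite metric \<Rightarrow> real^'n \<Rightarrow> real^'n^'n" where
  "ricci g p = (\<chi> b d. \<Sum>a\<in>UNIV. riemann g a b a d p)"

definition scalar_curvature :: "'n::finite metric \<Rightarrow> real^'n \<Rightarrow> real" where
  "scalar_curvature g p = (\<Sum>a\<in>UNIV. \<Sum>b\<in>UNIV. inverse_metric g p $ a $ b * ricci g p $ a $ b)"

definition einstein :: "'n::finite metric \<Rightarrow> real^'n \<Rightarrow> real^'n^'n" where
  "einstein g p = ricci g p - (1/2 * scalar_curvature g p) *\<^sub>R g p"

definition stress_energy :: "'n::finite metric \<Rightarrow> real^'n \<Rightarrow> real^'n^'n" where
  "stress_energy g p = (1 / (8 * pi)) *\<^sub>R einstein g p"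

definition stress_energy_mixed :: "'n::finite metric \<Rightarrow> real^'n \<Rightarrow> real^'n^'n" where
  "stress_energy_mixed g p = (\<chi> a b. \<Sum>c\<in>UNIV. inverse_metric g p $ a $ c * stress_energy g p $ c $ b)"

section \<open>Flat-slice unit-lapse spacetimes\<close>

text \<open>Spacetime coordinates are indexed by the four-element type \<open>3 option\<close>: \<open>None\<close> is the time
  index and \<open>Some i\<close> the spatial index \<open>i\<close>.\<close>

type_synonym spacetime = "real^(3 option)"

definition spatial_part :: "spacetime \<Rightarrow> real^3" where
  "spatial_part p = (\<chi> i. p $ Some i)"

text \<open>The components of the 1-forms \<open>dt\<close> and \<open>dx\<^sup>i + \<beta>\<^sup>i dt\<close>; the metric is
  \<open>- dt\<^sup>2 + \<delta>\<^sub>i\<^sub>j (dx\<^sup>i + \<beta>\<^sup>i dt) (dx\<^sup>j + \<beta>\<^sup>j dt)\<close>. The shift is static, so it is a function of the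
  spatial coordinates only; as the slices are flat, \<open>\<beta>\<^sup>i\<close> and \<open>\<beta>\<^sub>i\<close> coincide.\<close>

definition dt :: spacetime where
  "dt = axis None 1"

definition coframe :: "(real^3 \<Rightarrow> real^3) \<Rightarrow> spacetime \<Rightarrow> 3 \<Rightarrow> spacetime" where
  "coframe \<beta> p i = axis (Some i) 1 + (\<beta> (spatial_part p) $ i) *\<^sub>R dt"

definition shift_metric :: "(real^3 \<Rightarrow> real^3) \<Rightarrow> (3 option) metric" where
  "shift_metric \<beta> p =
     (\<chi> a b. - (dt $ a * dt $ b) + (\<Sum>i\<in>UNIV. coframe \<beta> p i $ a * coframe \<beta> p i $ b))"

definition normal :: "(real^3 \<Rightarrow> real^3) \<Rightarrow> spacetime \<Rightarrow> spacetime" where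
  "normal \<beta> p = axis None 1 - (\<Sum>i\<in>UNIV. (\<beta> (spatial_part p) $ i) *\<^sub>R axis (Some i) 1)"

definition normal_lowered :: "(real^3 \<Rightarrow> real^3) \<Rightarrow> spacetime \<Rightarrow> spacetime" where
  "normal_lowered \<beta> p = shift_metric \<beta> p *v normal \<beta> p"

definition projection :: "(real^3 \<Rightarrow> real^3) \<Rightarrow> spacetime \<Rightarrow> real^(3 option)^(3 option)" where
  "projection \<beta> p =
     (\<chi> a b. (if a = b then 1 else 0) + normal \<beta> p $ a * normal_lowered \<beta> p $ b)"

definition momentum_density :: "(real^3 \<Rightarrow> real^3) \<Rightarrow> spacetime \<Rightarrow> real^3" where
  "momentum_density \<beta> p = (\<chi> i. - (\<Sum>a\<in>UNIV. \<Sum>b\<in>UNIV.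
     projection \<beta> p $ Some i $ a * stress_energy_mixed (shift_metric \<beta>) p $ a $ b * normal \<beta> p $ b))"

definition extrinsic_curvature :: "(real^3 \<Rightarrow> real^3) \<Rightarrow> real^3 \<Rightarrow> real^3^3" where
  "extrinsic_curvature \<beta> x =
     (\<chi> i j. - (1/2) * (partial i (\<lambda>y. \<beta> y $ j) x + partial j (\<lambda>y. \<beta> y $ i) x))"

lemma sum_option: "(\<Sum>a\<in>UNIV. f a) = f None + (\<Sum>i\<in>UNIV. f (Some i))"
  for f :: "'a::finite option \<Rightarrow> real"
  by (simp add: UNIV_option_conv sum.reindex)

lemma shift_metric_components:
  "shift_metric \<beta> p $ None $ None = - 1 + \<beta> (spatial_part p) \<bullet> \<beta> (spatial_part p)"
  "shift_metric \<beta> p $ None $ Some i = \<beta> (spatial_part p) $ i"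
  "shift_metric \<beta> p $ Some i $ None = \<beta> (spatial_part p) $ i"
  "shift_metric \<beta> p $ Some i $ Some j = (if i = j then 1 else 0)"
proof -
  have *: "coframe \<beta> p k $ None = \<beta> (spatial_part p) $ k"
    "coframe \<beta> p k $ Some l = of_bool (l = k)" for k l
    by (simp_all add: coframe_def dt_def axis_def)
  have [simp]: "dt $ None = 1" "dt $ Some l = 0" for l
    by (simp_all add: dt_def axis_def)
  show "shift_metric \<beta> p $ None $ None = - 1 + \<beta> (spatial_part p) \<bullet> \<beta> (spatial_part p)"
    by (simp add: shift_metric_def * inner_vec_def)
  show "shift_metric \<beta> p $ None $ Some i = \<beta> (spatial_part p) $ i"
    by (simp add: shift_metric_def * of_bool_def mult_delta_right)
  show "shift_metric \<beta> p $ Some i $ None = \<beta> (spatial_part p) $ i"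
    by (simp add: shift_metric_def * of_bool_def mult_delta_left)
  show "shift_metric \<beta> p $ Some i $ Some j = (if i = j then 1 else 0)"
    by (simp add: shift_metric_def * of_bool_def mult_delta_left)
qed

lemma normal_components:
  "normal \<beta> p $ None = 1"
  "normal \<beta> p $ Some i = - \<beta> (spatial_part p) $ i"
  by (simp_all add: normal_def axis_def if_distrib cong: if_cong)

lemma normal_lowered_eq: "normal_lowered \<beta> p = - dt"
proof -
  have "normal_lowered \<beta> p $ None = - dt $ None"
    by (simp add: normal_lowered_def matrix_vector_mult_def sum_option shift_metric_components
        normal_components dt_def axis_def inner_vec_def sum_negf)
  moreover have "normal_lowered \<beta> p $ Some i = - dt $ Some i" for i
    by (simp add: normal_lowered_def matrix_vector_mult_def sum_option shift_metric_components
        normal_components dt_def axis_def sum_negf mult_delta_left)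
  ultimately show ?thesis by (simp add: vec_eq_iff split_option_all)
qed

lemma normal_unit: "normal_lowered \<beta> p \<bullet> normal \<beta> p = - 1"
  by (simp add: normal_lowered_eq dt_def inner_axis' normal_components)

text \<open>The metric matrix is invertible, so its inverse is the genuine inverse metric.\<close>

lemma inverse_metric_left: "inverse_metric (shift_metric \<beta>) p ** shift_metric \<beta> p = mat 1"
proof -
  let ?b = "\<beta> (spatial_part p)" and ?g = "shift_metric \<beta> p"
  define h :: "real^(3 option)^(3 option)" where
    "h = (\<chi> a b. case a of
        None \<Rightarrow> (case b of None \<Rightarrow> - 1 | Some j \<Rightarrow> ?b $ j)
      | Some i \<Rightarrow> (case b of None \<Rightarrow> ?b $ i | Some j \<Rightarrow> (if i = j then 1 else 0) - ?b $ i * ?b $ j))"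
  note [simp] = matrix_matrix_mult_def sum_option shift_metric_components mat_def
  have "(h ** ?g) $ None $ None = (mat 1 :: real^(3 option)^(3 option)) $ None $ None"
    by (simp add: h_def inner_vec_def)
  moreover have "(h ** ?g) $ None $ Some j = (mat 1 :: real^(3 option)^(3 option)) $ None $ Some j" for j
    by (simp add: h_def mult_delta_right)
  moreover have "(h ** ?g) $ Some i $ None = (mat 1 :: real^(3 option)^(3 option)) $ Some i $ None" for i
    by (simp add: h_def left_diff_distrib mult_delta_left sum_subtractf inner_vec_def
        right_diff_distrib sum_distrib_left mult.assoc)
  moreover have "(h ** ?g) $ Some i $ Some j = (mat 1 :: real^(3 option)^(3 option)) $ Some i $ Some j" for i j
    by (simp add: h_def left_diff_distrib mult_delta_right sum_subtractf)
  ultimately have "h ** ?g = mat 1" by (simp only: vec_eq_iff split_option_all) blast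
  then have "invertible ?g" using invertible_left_inverse by blast
  then have "\<exists>A. ?g ** A = mat 1 \<and> A ** ?g = mat 1" by (simp only: invertible_def)
  from someI_ex[OF this] show ?thesis unfolding inverse_metric_def matrix_inv_def by (rule conjunct2)
qed

end

theory Submission
  imports Defs
begin

text \<open>The Christoffel symbols split into the strain (symmetric part) and twist (antisymmetric part, half
  the vorticity) of the Jacobian of \<open>\<beta>\<close>. The momentum density is the projection of \<open>- R\<^sub>a\<^sub>b n\<^sup>b / 8\<pi>\<close>, in
  which all terms quadratic in first derivatives cancel; what remains is a multiple of the divergence of
  the twist, i.e. \<open>curl (curl \<beta>)\<close>. If it vanishes, the twist is a closed and divergence-free 2-form, hence
  harmonic, hence constant by Liouville's theorem when bounded. Subtracting the rotation with
  that twist leaves a curl-free field, a gradient by the Poincare lemma. Conversely the twist of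
  \<open>\<nabla>\<phi> + \<Omega> \<times> x\<close> is constant.\<close>

section \<open>Calculus of partial derivatives\<close>

text \<open>Boundedness is what rules out further solutions: if h is harmonic on R^3 and curl beta =
  grad h, then curl (curl beta) = 0, so the momentum density vanishes, although beta has the
  required form only when grad h is constant. Liouville's theorem is therefore the analytic core. It
  is needed for scalar functions only, because the twist is treated entry by entry. Spherical means
  are replaced by means against powers of max 0 (1 - |y|^2) over a fixed box: the gradient of such a
  power is y times the preceding power, up to a constant, so integration by parts needs neither
  surface measures nor infinitely differentiable cutoffs. On the geometric side the Ricci tensor can
  stand in for the Einstein tensor because the trace part is proportional to the spatial components
  of the lowered normal, which are zero.\<close>

lemma partial_eqI: "(f has_derivative D) (at x) \<Longrightarrow> partial i f x = D (axis i 1)"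
  by (simp add: partial_def frechet_derivative_at[symmetric])

lemma has_derivative_partials:
  assumes "f differentiable (at x)"
  shows "(f has_derivative (\<lambda>h. \<Sum>i\<in>UNIV. h $ i *\<^sub>R partial i f x)) (at x)"
proof -
  let ?D = "frechet_derivative f (at x)"
  have D: "(f has_derivative ?D) (at x)"
    using assms by (simp add: frechet_derivative_works)
  interpret bounded_linear ?D using D by (rule has_derivative_bounded_linear)
  have "?D h = (\<Sum>i\<in>UNIV. h $ i *\<^sub>R partial i f x)" for h
  proof -
    have "?D h = ?D (\<Sum>i\<in>UNIV. h $ i *\<^sub>R axis i 1)"
      by (simp only: basis_expansion scalar_mult_eq_scaleR[symmetric])
    then show ?thesis by (simp add: sum scaleR partial_def)
  qed
  then have "?D = (\<lambda>h. \<Sum>i\<in>UNIV. h $ i *\<^sub>R partial i f x)" ..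
  with D show ?thesis by simp
qed

lemma partial_const [simp]: "partial i (\<lambda>x. c) = (\<lambda>x. 0)"
  by (simp add: partial_eqI[OF has_derivative_const] fun_eq_iff)

lemma partial_bounded_linear:
  assumes "bounded_linear L" "f differentiable (at x)"
  shows "partial i (\<lambda>x. L (f x)) x = L (partial i f x)"
proof -
  from assms(2) obtain D where D: "(f has_derivative D) (at x)"
    by (auto simp: differentiable_def)
  show ?thesis
    using partial_eqI[OF bounded_linear.has_derivative[OF assms(1) D]] partial_eqI[OF D] by simp
qed

lemma partial_add:
  assumes "f differentiable (at x)" "g differentiable (at x)"
  shows "partial i (\<lambda>x. f x + g x) x = partial i f x + partial i g x"
proof -
  from assms obtain D E where D: "(f has_derivative D) (at x)" "(g has_derivative E) (at x)"
    by (auto simp: differentiable_def)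
  show ?thesis
    using partial_eqI[OF has_derivative_add[OF D]] D[THEN partial_eqI] by simp
qed

lemma partial_minus:
  assumes "f differentiable (at x)"
  shows "partial i (\<lambda>x. - f x) x = - partial i f x"
  using partial_bounded_linear[OF bounded_linear_minus[OF bounded_linear_ident] assms] .

lemma partial_diff:
  assumes "f differentiable (at x)" "g differentiable (at x)"
  shows "partial i (\<lambda>x. f x - g x) x = partial i f x - partial i g x"
  using partial_add[OF assms(1) differentiable_minus[OF assms(2)], of i] partial_minus[OF assms(2)]
  by simp

lemma partial_sum:
  assumes "\<And>k. f k differentiable (at x)"
  shows "partial i (\<lambda>x. \<Sum>k\<in>K. f k x) x = (\<Sum>k\<in>K. partial i (f k) x)"
proof -
  have *: "(f k has_derivative frechet_derivative (f k) (at x)) (at x)" for k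
    using assms by (simp add: frechet_derivative_works)
  show ?thesis
    using partial_eqI[OF has_derivative_sum[of K f, OF *]] partial_eqI[OF *] by simp
qed

lemma partial_mult:
  fixes f g :: "real^'n::finite \<Rightarrow> real"
  assumes "f differentiable (at x)" "g differentiable (at x)"
  shows "partial i (\<lambda>x. f x * g x) x = f x * partial i g x + partial i f x * g x"
proof -
  from assms obtain D E where D: "(f has_derivative D) (at x)" "(g has_derivative E) (at x)"
    by (auto simp: differentiable_def)
  show ?thesis
    using partial_eqI[OF has_derivative_mult[OF D]] D[THEN partial_eqI] by simp
qed

text \<open>\<open>foldr\<close> applies the last index of the list first, so splitting a list at
  its end (\<open>is @ [i]\<close>, \<open>rev_cases\<close>) moves one derivative onto
  \<open>f\<close> itself.\<close>

lemma smooth_iff: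
  "smooth f \<longleftrightarrow> (\<forall>x. f differentiable (at x)) \<and> (\<forall>i. smooth (partial i f))"
proof
  assume *: "smooth f"
  have "foldr partial [] f differentiable (at x)" for x
    using * unfolding smooth_def by blast
  moreover have "foldr partial (is @ [i]) f differentiable (at x)" for i "is" x
    using * unfolding smooth_def by blast
  ultimately show "(\<forall>x. f differentiable (at x)) \<and> (\<forall>i. smooth (partial i f))"
    by (simp add: smooth_def)
next
  assume *: "(\<forall>x. f differentiable (at x)) \<and> (\<forall>i. smooth (partial i f))"
  have "foldr partial is f differentiable (at x)" for "is" x
    using * by (cases "is" rule: rev_cases) (auto simp: smooth_def)
  then show "smooth f" by (simp add: smooth_def)
qed

lemma smooth_differentiable: "smooth f \<Longrightarrow> f differentiable (at x)"
  using smooth_iff by blast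

lemma smooth_partial: "smooth f \<Longrightarrow> smooth (partial i f)"
  using smooth_iff by blast

lemma smooth_continuous_on: "smooth f \<Longrightarrow> continuous_on S f"
  by (meson continuous_at_imp_continuous_on differentiable_imp_continuous_within smooth_differentiable)

lemma smooth_const:
  fixes c :: "'b::real_normed_vector"
  shows "smooth (\<lambda>x :: real^'n::finite. c)"
proof -
  have "foldr partial is (\<lambda>x :: real^'n. c) = (\<lambda>x. if is = [] then c else 0)" for "is"
    by (induction "is") auto
  moreover have "(\<lambda>x. if is = [] then c else 0) differentiable (at x)" for x :: "real^'n" and "is" :: "'n list"
    by simp
  ultimately show ?thesis by (simp only: smooth_def) simp
qed

lemma smooth_bounded_linear_compose:
  assumes "bounded_linear L" "smooth f"
  shows "smooth (\<lambda>x. L (f x))"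
proof -
  have d: "foldr partial is f differentiable (at x)" for "is" x
    using assms(2) by (simp add: smooth_def)
  have "foldr partial is (\<lambda>x. L (f x)) = (\<lambda>x. L (foldr partial is f x))" for "is"
  proof (induction "is")
    case (Cons i "is")
    then show ?case using partial_bounded_linear[OF assms(1) d] by auto
  qed auto
  moreover have "(\<lambda>x. L (foldr partial is f x)) differentiable (at x)" for "is" x
    using d[of "is" x] unfolding differentiable_def
    by (blast intro: bounded_linear.has_derivative[OF assms(1)])
  ultimately show ?thesis by (simp add: smooth_def)
qed

lemma smooth_bounded_linear:
  assumes "bounded_linear L"
  shows "smooth L"
proof -
  have d: "(L has_derivative L) (at x)" for x
    by (rule bounded_linear.has_derivative[OF assms has_derivative_ident])
  have "partial i L = (\<lambda>x. L (axis i 1))" for i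
    using partial_eqI[OF d] by blast
  then show ?thesis
    using d smooth_const by (subst smooth_iff) (auto simp: differentiable_def)
qed

lemma smooth_add:
  assumes "smooth f" "smooth g"
  shows "smooth (\<lambda>x. f x + g x)"
proof -
  have d: "foldr partial is f differentiable (at x)" "foldr partial is g differentiable (at x)" for "is" x
    using assms by (simp_all add: smooth_def)
  have "foldr partial is (\<lambda>x. f x + g x) = (\<lambda>x. foldr partial is f x + foldr partial is g x)" for "is"
  proof (induction "is")
    case (Cons i "is")
    then show ?case using partial_add[OF d] by auto
  qed auto
  then show ?thesis
    using differentiable_add[OF d] by (simp add: smooth_def)
qed

lemma smooth_minus: "smooth f \<Longrightarrow> smooth (\<lambda>x. - f x)"
  using smooth_bounded_linear_compose[OF bounded_linear_minus[OF bounded_linear_ident]] .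

lemma smooth_diff: "smooth f \<Longrightarrow> smooth g \<Longrightarrow> smooth (\<lambda>x. f x - g x)"
  using smooth_add[OF _ smooth_minus] by fastforce

lemma smooth_component: "smooth f \<Longrightarrow> smooth (\<lambda>x. f x $ i)"
  by (rule smooth_bounded_linear_compose[OF bounded_linear_vec_nth])

lemma smooth_scale:
  fixes f :: "real^'n::finite \<Rightarrow> real"
  shows "smooth f \<Longrightarrow> smooth (\<lambda>x. c * f x)"
  by (rule smooth_bounded_linear_compose[OF bounded_linear_mult_right])

section \<open>Derivatives along coordinate lines and symmetry of second partials\<close>

lemma has_vector_derivative_line:
  assumes "f differentiable (at (x + t *\<^sub>R axis i 1))"
  shows "((\<lambda>t. f (x + t *\<^sub>R axis i 1)) has_vector_derivative
           partial i f (x + t *\<^sub>R axis i 1)) (at t within S)"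
proof -
  have "((\<lambda>t. x + t *\<^sub>R axis i (1::real)) has_derivative (\<lambda>h. h *\<^sub>R axis i 1)) (at t within S)"
    by (auto intro!: derivative_eq_intros)
  from has_derivative_compose[OF this has_derivative_partials[OF assms]]
  have "((\<lambda>t. f (x + t *\<^sub>R axis i 1)) has_derivative
         (\<lambda>h. \<Sum>j\<in>UNIV. (h *\<^sub>R axis i 1) $ j *\<^sub>R partial j f (x + t *\<^sub>R axis i 1))) (at t within S)"
    by simp
  moreover have "(\<Sum>j\<in>UNIV. (h *\<^sub>R axis i 1) $ j *\<^sub>R partial j f (x + t *\<^sub>R axis i 1))
      = h *\<^sub>R partial i f (x + t *\<^sub>R axis i 1)" for h :: real
    by (simp add: axis_def if_distrib if_distribR cong: if_cong)
  ultimately show ?thesis by (simp add: has_vector_derivative_def)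
qed

text \<open>Used where an identity is known only for nonnegative parameters, for instance because
  \<open>integral {0..s}\<close> is the oriented integral only when 0 \<le> s. One-sided derivatives
  at 0 are then all that can be compared.\<close>

lemma vector_derivative_unique_0:
  assumes "(f has_vector_derivative a) (at (0::real) within {0..1})"
    and "(f has_vector_derivative b) (at 0 within {0..1})"
  shows "a = b"
  using vector_derivative_unique_within_closed_interval[of 0 1 0 f a b] assms by simp

text \<open>The fundamental theorem of calculus in direction \<open>i\<close>, differentiated under the integral sign in
  direction \<open>j\<close>, and then differentiated in direction \<open>i\<close>.\<close>

lemma partial_commute:
  fixes f :: "real^'n::finite \<Rightarrow> 'b::banach"
  assumes "smooth f"
  shows "partial i (partial j f) x = partial j (partial i f) x"
proof -
  let ?e = "\<lambda>k. axis k 1 :: real^'n"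
  note d = smooth_differentiable[OF assms] and di = smooth_differentiable[OF smooth_partial[OF assms]]
  note cont [continuous_intros] =
    continuous_on_compose2[OF smooth_continuous_on[OF assms, of UNIV]]
    continuous_on_compose2[OF smooth_continuous_on[OF smooth_partial[OF assms], of UNIV]]
    continuous_on_compose2[OF smooth_continuous_on[OF smooth_partial[OF smooth_partial[OF assms]], of UNIV]]
  have ftc: "f (y + s *\<^sub>R ?e i) = f y + integral {0..s} (\<lambda>r. partial i f (y + r *\<^sub>R ?e i))"
    if "0 \<le> s" for y s
  proof -
    have "((\<lambda>r. partial i f (y + r *\<^sub>R ?e i)) has_integral
        f (y + s *\<^sub>R ?e i) - f (y + 0 *\<^sub>R ?e i)) {0..s}"
      by (rule fundamental_theorem_of_calculus[OF that has_vector_derivative_line[OF d]])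
    then show ?thesis by (simp add: integral_unique)
  qed
  have inner: "partial j f (x + s *\<^sub>R ?e i) =
      partial j f x + integral {0..s} (\<lambda>r. partial j (partial i f) (x + r *\<^sub>R ?e i))"
    if s: "0 \<le> s" for s
  proof -
    have "((\<lambda>t. integral (cbox 0 s) (\<lambda>r. partial i f ((x + r *\<^sub>R ?e i) + t *\<^sub>R ?e j))) has_vector_derivative
        integral (cbox 0 s) (\<lambda>r. partial j (partial i f) ((x + r *\<^sub>R ?e i) + 0 *\<^sub>R ?e j))) (at 0 within UNIV)"
      by (rule leibniz_rule_vector_derivative
          [where fx = "\<lambda>t r. partial j (partial i f) ((x + r *\<^sub>R ?e i) + t *\<^sub>R ?e j)"])
        (auto intro!: has_vector_derivative_line di integrable_continuous_interval continuous_intros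
          simp: split_beta)
    moreover have "((\<lambda>t. f (x + t *\<^sub>R ?e j)) has_vector_derivative partial j f (x + 0 *\<^sub>R ?e j)) (at 0)"
      by (rule has_vector_derivative_line[OF d])
    ultimately have "((\<lambda>t. f (x + t *\<^sub>R ?e j) +
          integral {0..s} (\<lambda>r. partial i f ((x + t *\<^sub>R ?e j) + r *\<^sub>R ?e i))) has_vector_derivative
        partial j f x + integral {0..s} (\<lambda>r. partial j (partial i f) (x + r *\<^sub>R ?e i))) (at 0)"
      by (auto intro!: derivative_eq_intros simp: algebra_simps)
    moreover have "((\<lambda>t. f ((x + s *\<^sub>R ?e i) + t *\<^sub>R ?e j)) has_vector_derivative
        partial j f ((x + s *\<^sub>R ?e i) + 0 *\<^sub>R ?e j)) (at 0)"
      by (rule has_vector_derivative_line[OF d])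
    moreover have "(\<lambda>t. f ((x + s *\<^sub>R ?e i) + t *\<^sub>R ?e j)) = (\<lambda>t. f (x + t *\<^sub>R ?e j) +
          integral {0..s} (\<lambda>r. partial i f ((x + t *\<^sub>R ?e j) + r *\<^sub>R ?e i)))"
      using ftc[OF s, of "x + t *\<^sub>R ?e j" for t] by (simp add: fun_eq_iff add_ac)
    ultimately have "partial j f x + integral {0..s} (\<lambda>r. partial j (partial i f) (x + r *\<^sub>R ?e i)) =
        partial j f ((x + s *\<^sub>R ?e i) + 0 *\<^sub>R ?e j)"
      by (simp only: vector_derivative_unique_at)
    then show ?thesis by simp
  qed
  have "((\<lambda>s. integral {0..s} (\<lambda>r. partial j (partial i f) (x + r *\<^sub>R ?e i))) has_vector_derivative
      partial j (partial i f) (x + 0 *\<^sub>R ?e i)) (at 0 within {0..1})"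
    by (rule integral_has_vector_derivative) (auto intro!: continuous_intros)
  then have "((\<lambda>s. partial j f x + integral {0..s} (\<lambda>r. partial j (partial i f) (x + r *\<^sub>R ?e i)))
      has_vector_derivative partial j (partial i f) x) (at 0 within {0..1})"
    by (auto intro!: derivative_eq_intros)
  then have "((\<lambda>s. partial j f (x + s *\<^sub>R ?e i)) has_vector_derivative
      partial j (partial i f) x) (at 0 within {0..1})"
    by (rule has_vector_derivative_transform[rotated 2]) (auto simp: inner)
  moreover have "((\<lambda>s. partial j f (x + s *\<^sub>R ?e i)) has_vector_derivative
      partial i (partial j f) (x + 0 *\<^sub>R ?e i)) (at 0 within {0..1})"
    by (rule has_vector_derivative_line[OF di])
  ultimately have "partial j (partial i f) x = partial i (partial j f) (x + 0 *\<^sub>R ?e i)"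
    by (rule vector_derivative_unique_0)
  then show ?thesis by simp
qed

section \<open>Liouville's theorem for harmonic functions\<close>

lemma partial_compose_affine:
  assumes "f differentiable (at (x + r *\<^sub>R y))"
  shows "partial i (\<lambda>y. f (x + r *\<^sub>R y)) y = r *\<^sub>R partial i f (x + r *\<^sub>R y)"
    and "(\<lambda>y. f (x + r *\<^sub>R y)) differentiable (at y)"
proof -
  from assms obtain D where D: "(f has_derivative D) (at (x + r *\<^sub>R y))"
    by (auto simp: differentiable_def)
  have "((\<lambda>y. x + r *\<^sub>R y) has_derivative (\<lambda>h. r *\<^sub>R h)) (at y)"
    by (auto intro!: derivative_eq_intros)
  from has_derivative_compose[OF this D]
  have E: "((\<lambda>y. f (x + r *\<^sub>R y)) has_derivative (\<lambda>h. D (r *\<^sub>R h))) (at y)" .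
  interpret bounded_linear D using D by (rule has_derivative_bounded_linear)
  show "partial i (\<lambda>y. f (x + r *\<^sub>R y)) y = r *\<^sub>R partial i f (x + r *\<^sub>R y)"
    using partial_eqI[OF E] partial_eqI[OF D] by (simp add: scaleR)
  show "(\<lambda>y. f (x + r *\<^sub>R y)) differentiable (at y)"
    using E by (auto simp: differentiable_def)
qed

text \<open>The Leibniz and translation rules for integrals are stated for \<open>cbox\<close>, so a
  box replaces the ball that carries the weights. Half-width 2 leaves a margin of 1 around the unit
  ball.\<close>

abbreviation cube :: "(real^'n::finite) set" where
  "cube \<equiv> cbox (\<chi> i. - 2) (\<chi> i. 2)"

text \<open>Translating a function supported in the unit ball by at most a unit does not move its support
  out of the cube, so the integral over the cube does not change; its derivative with respect
  to the translation is the integral of the partial derivative.\<close>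

lemma integral_partial_eq_0:
  fixes F :: "real^'n::finite \<Rightarrow> real"
  assumes d: "\<And>x. F differentiable (at x)" and c: "continuous_on UNIV (partial i F)"
    and supp: "\<And>y. norm y > 1 \<Longrightarrow> F y = 0"
  shows "integral cube (partial i F) = 0"
proof -
  let ?e = "axis i 1 :: real^'n"
  have contF: "continuous_on S F" for S
    using d by (meson continuous_at_imp_continuous_on differentiable_imp_continuous_within)
  have shift: "integral cube (\<lambda>y. F (y + t *\<^sub>R ?e)) = integral UNIV F" if "t \<in> {0..1}" for t
  proof -
    let ?K = "cbox ((\<chi> i. - 2) + t *\<^sub>R ?e) ((\<chi> i. 2) + t *\<^sub>R ?e)"
    have "F y = 0" if "y \<notin> ?K" for y
    proof (rule supp, rule ccontr)
      assume "\<not> 1 < norm y"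
      then have "\<bar>y $ k\<bar> \<le> 1" for k
        by (meson component_le_norm_cart dual_order.trans not_less)
      then have b: "y $ k \<le> 1" "- 1 \<le> y $ k" for k by (smt (verit))+
      have "0 \<le> (t *\<^sub>R ?e) $ k" "(t *\<^sub>R ?e) $ k \<le> 1" for k
        using \<open>t \<in> {0..1}\<close> by (auto simp: axis_def)
      with b have "y \<in> ?K"
        by (simp add: mem_box_cart) (smt (verit))
      with that show False by simp
    qed
    then have "(\<lambda>y. if y \<in> ?K then F y else 0) = F" by auto
    then have "integral UNIV F = integral ?K F"
      using integral_restrict_UNIV[of ?K F] by simp
    also have "\<dots> = integral cube (\<lambda>y. F (y + t *\<^sub>R ?e))"
      using integral_shift_cbox_plus[of "\<chi> i. - 2" "\<chi> i. 2" F "t *\<^sub>R ?e"]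
      by (simp add: o_def add.commute)
    finally show ?thesis ..
  qed
  have "((\<lambda>t. integral cube (\<lambda>y. F (y + t *\<^sub>R ?e))) has_vector_derivative
      integral cube (\<lambda>y. partial i F (y + 0 *\<^sub>R ?e))) (at 0 within {0..1})"
    by (rule leibniz_rule_vector_derivative[where fx = "\<lambda>t y. partial i F (y + t *\<^sub>R ?e)"])
      (auto intro!: has_vector_derivative_line d integrable_continuous continuous_intros
        continuous_on_compose2[OF contF[of UNIV]] continuous_on_compose2[OF c] simp: split_beta)
  then have "((\<lambda>t. integral cube (\<lambda>y. F (y + t *\<^sub>R ?e))) has_vector_derivative
      integral cube (partial i F)) (at 0 within {0..1})"
    by simp
  then have "((\<lambda>t. integral UNIV F) has_vector_derivative integral cube (partial i F)) (at 0 within {0..1})"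
    by (rule has_vector_derivative_transform[rotated 2]) (auto simp: shift)
  moreover have "((\<lambda>t. integral UNIV F) has_vector_derivative 0) (at 0 within {0..1})"
    by simp
  ultimately show ?thesis
    by (rule vector_derivative_unique_0)
qed

text \<open>From the second power on, the kink of \<open>max 0 s\<close> at 0 is flattened; hence
  the exponent \<open>Suc (Suc k)\<close>.\<close>

lemma has_real_derivative_max_0_power:
  "((\<lambda>s. max 0 s ^ Suc (Suc k)) has_real_derivative real (Suc (Suc k)) * max 0 s ^ Suc k) (at s)"
proof (cases s "0 :: real" rule: linorder_cases)
  case less
  have "((\<lambda>s. 0) has_real_derivative 0) (at s)" by simp
  then have "((\<lambda>s. max 0 s ^ Suc (Suc k)) has_real_derivative 0) (at s)"
    by (rule has_field_derivative_transform_within_open[of _ _ _ "{..<0}"]) (use less in auto)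
  with less show ?thesis by simp
next
  case equal
  \<comment> \<open>Caratheodory's criterion: the slope function is \<open>max 0 z ^ Suc k\<close>,
    continuous and zero at 0. The \<open>isCont\<close> goal below fixes this witness.\<close>
  have "\<exists>g. (\<forall>z. max 0 z ^ Suc (Suc k) - max 0 0 ^ Suc (Suc k) = g z * (z - 0)) \<and> isCont g 0 \<and> g 0 = (0 :: real)"
  proof (intro exI conjI allI)
    show "isCont (\<lambda>z. max 0 z ^ Suc k) (0 :: real)" by (intro continuous_intros)
  qed (auto simp: max_def)
  then show ?thesis unfolding equal by (subst CARAT_DERIV) simp
next
  case greater
  have "((\<lambda>s. s ^ Suc (Suc k)) has_real_derivative real (Suc (Suc k)) * s ^ Suc k) (at s)"
    by (rule DERIV_pow2)
  then have "((\<lambda>s. max 0 s ^ Suc (Suc k)) has_real_derivative real (Suc (Suc k)) * s ^ Suc k) (at s)"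
    by (rule has_field_derivative_transform_within_open[of _ _ _ "{0<..}"]) (use greater in auto)
  with greater show ?thesis by simp
qed

text \<open>A weight supported in the closed unit ball for \<open>k > 0\<close>, and continuously
  differentiable once \<open>k\<close> is at least 2. Lowering the exponent by one is, up to a
  factor, taking the radial part of the gradient.\<close>

definition bump :: "nat \<Rightarrow> real^'n::finite \<Rightarrow> real" where
  "bump k y = max 0 (1 - y \<bullet> y) ^ k"

lemma bump_eq_0: "norm y > 1 \<Longrightarrow> k > 0 \<Longrightarrow> bump k y = 0"
  by (simp add: bump_def max_def dot_square_norm power_le_one_iff)

lemma continuous_on_bump [continuous_intros]: "continuous_on S (bump k)"
  unfolding bump_def by (intro continuous_intros)

lemma bump_derivative:
  fixes y :: "real^'n::finite"
  shows "bump (Suc (Suc k)) differentiable (at y)"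
    and "partial i (bump (Suc (Suc k))) y = - 2 * real (Suc (Suc k)) * y $ i * bump (Suc k) y"
proof -
  have "((\<lambda>y :: real^'n. 1 - y \<bullet> y) has_derivative (\<lambda>h. - 2 * (h \<bullet> y))) (at y)"
    by (auto intro!: derivative_eq_intros simp: inner_commute)
  from has_derivative_compose[OF this has_real_derivative_max_0_power[unfolded has_field_derivative_def]]
  have D: "(bump (Suc (Suc k)) has_derivative
      (\<lambda>h. real (Suc (Suc k)) * max 0 (1 - y \<bullet> y) ^ Suc k * (- 2 * (h \<bullet> y)))) (at y)"
    unfolding bump_def .
  then show "bump (Suc (Suc k)) differentiable (at y)" by (auto simp: differentiable_def)
  show "partial i (bump (Suc (Suc k))) y = - 2 * real (Suc (Suc k)) * y $ i * bump (Suc k) y"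
    using partial_eqI[OF D, of i] by (simp add: inner_axis' bump_def algebra_simps)
qed

text \<open>A continuous nonnegative function with zero integral vanishes on the box, whereas the
  weight is 1 at the origin. Positivity allows division by the total mass.\<close>

lemma integral_bump_pos: "integral cube (bump k :: real^'n::finite \<Rightarrow> real) > 0"
proof -
  let ?b = "bump k :: real^'n \<Rightarrow> real"
  have int: "?b integrable_on cube" by (rule integrable_continuous) (rule continuous_on_bump)
  have nonneg: "0 \<le> ?b y" for y by (simp add: bump_def)
  have "integral cube ?b \<noteq> 0"
  proof
    assume "integral cube ?b = 0"
    with int have "(?b has_integral 0) cube" by (simp add: has_integral_integrable_integral)
    moreover have "0 \<in> box (\<chi> i. - 2) ((\<chi> i. 2) :: real^'n)" "(0 :: real^'n) \<in> cube"
      by (simp_all add: mem_box_cart)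
    ultimately have "?b 0 = 0"
      by (intro has_integral_0_cbox_imp_0[OF continuous_on_bump nonneg]) auto
    then show False by (simp add: bump_def)
  qed
  moreover have "integral cube ?b \<ge> 0" by (rule integral_nonneg[OF int nonneg])
  ultimately show ?thesis by simp
qed

text \<open>The product of \<open>g (x + r y)\<close> and \<open>h y\<close> vanishes outside the
  unit ball, so there is no boundary term. The chain rule supplies the factor \<open>r\<close> on
  the left, which later makes the gradient estimate decay as \<open>r\<close> grows.\<close>

lemma integral_by_parts:
  fixes g h :: "real^'n::finite \<Rightarrow> real"
  assumes g: "smooth g" and dh: "\<And>y. h differentiable (at y)" and ch: "continuous_on UNIV (partial i h)"
    and supp: "\<And>y. norm y > 1 \<Longrightarrow> h y = 0"
  shows "r * integral cube (\<lambda>y. partial i g (x + r *\<^sub>R y) * h y)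
       = - integral cube (\<lambda>y. g (x + r *\<^sub>R y) * partial i h y)"
proof -
  note dg = partial_compose_affine[OF smooth_differentiable[OF g], where x = x and r = r]
  have conth: "continuous_on S h" for S
    using dh by (meson continuous_at_imp_continuous_on differentiable_imp_continuous_within)
  note [continuous_intros] = conth continuous_on_subset[OF ch subset_UNIV]
    continuous_on_compose2[OF smooth_continuous_on[OF g, of UNIV]]
    continuous_on_compose2[OF smooth_continuous_on[OF smooth_partial[OF g], of UNIV]]
  let ?F = "\<lambda>y. g (x + r *\<^sub>R y) * h y"
  have F: "partial i ?F = (\<lambda>y. g (x + r *\<^sub>R y) * partial i h y + r * (partial i g (x + r *\<^sub>R y) * h y))"
    using partial_mult[OF dg(2) dh] dg(1) by (simp add: fun_eq_iff)
  have "integral cube (partial i ?F) = 0"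
    by (rule integral_partial_eq_0) (auto simp: F supp intro!: differentiable_mult dg dh continuous_intros)
  then show ?thesis
    unfolding F by (subst (asm) integral_add) (auto intro!: integrable_continuous continuous_intros)
qed

text \<open>The weighted mean over the ball of radius \<open>r\<close> has a derivative in \<open>r\<close> which, by parts, is an
  integral of the Laplacian, because the weighted radial field is the gradient of the next
  power of the bump.\<close>

lemma harmonic_mean_value:
  fixes u :: "real^'n::finite \<Rightarrow> real"
  assumes u: "smooth u" and harm: "\<And>x. (\<Sum>i\<in>UNIV. partial i (partial i u) x) = 0"
  shows "integral cube (\<lambda>y. u (x + r *\<^sub>R y) * bump 2 y)
       = u x * integral cube (bump 2 :: real^'n \<Rightarrow> real)"
proof -
  let ?b = "bump 2 :: real^'n \<Rightarrow> real" and ?B = "bump 3 :: real^'n \<Rightarrow> real"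
  let ?M = "\<lambda>r. integral cube (\<lambda>y. u (x + r *\<^sub>R y) * ?b y)"
  let ?M' = "\<lambda>r. integral cube (\<lambda>y. (\<Sum>i\<in>UNIV. y $ i * partial i u (x + r *\<^sub>R y)) * ?b y)"
  note [continuous_intros] =
    continuous_on_compose2[OF smooth_continuous_on[OF u, of UNIV]]
    continuous_on_compose2[OF smooth_continuous_on[OF smooth_partial[OF u], of UNIV]]
    continuous_on_compose2[OF smooth_continuous_on[OF smooth_partial[OF smooth_partial[OF u]], of UNIV]]
    continuous_on_compose2[OF continuous_on_bump[of UNIV]]
  have M': "?M' r = 0" for r
  proof -
    \<comment> \<open>The constant is - 2 * 3, from the exponent of \<open>bump 3\<close>.\<close>
    have dB: "?B differentiable (at y)" "partial i ?B = (\<lambda>y. - 6 * (y $ i * ?b y))" for i y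
      using bump_derivative[where k = 1 and ?'n = 'n] by (simp_all add: numeral_eq_Suc fun_eq_iff mult.assoc)
    have parts: "r * integral cube (\<lambda>y. partial i (partial i u) (x + r *\<^sub>R y) * ?B y)
        = integral cube (\<lambda>y. partial i u (x + r *\<^sub>R y) * (6 * (y $ i * ?b y)))" for i
    proof -
      have "r * integral cube (\<lambda>y. partial i (partial i u) (x + r *\<^sub>R y) * ?B y)
          = - integral cube (\<lambda>y. partial i u (x + r *\<^sub>R y) * partial i ?B y)"
        by (rule integral_by_parts[OF smooth_partial[OF u] dB(1)])
          (auto simp: dB(2) bump_eq_0 intro!: continuous_intros)
      then show ?thesis by (simp add: dB(2))
    qed
    have "0 = r * integral cube (\<lambda>y. (\<Sum>i\<in>UNIV. partial i (partial i u) (x + r *\<^sub>R y)) * ?B y)"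
      by (simp add: harm)
    also have "\<dots> = (\<Sum>i\<in>UNIV. r * integral cube (\<lambda>y. partial i (partial i u) (x + r *\<^sub>R y) * ?B y))"
      unfolding sum_distrib_right
      by (subst integral_sum) (auto intro!: integrable_continuous continuous_intros simp: sum_distrib_left)
    also have "\<dots> = integral cube (\<lambda>y. \<Sum>i\<in>UNIV. partial i u (x + r *\<^sub>R y) * (6 * (y $ i * ?b y)))"
      unfolding parts
      by (subst integral_sum) (auto intro!: integrable_continuous continuous_intros)
    also have "\<dots> = integral cube (\<lambda>y. 6 * ((\<Sum>i\<in>UNIV. y $ i * partial i u (x + r *\<^sub>R y)) * ?b y))"
      by (simp add: sum_distrib_left sum_distrib_right algebra_simps)
    finally show ?thesis by simp
  qed
  have deriv: "((\<lambda>r. u (x + r *\<^sub>R y) * ?b y) has_vector_derivative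
      (\<Sum>i\<in>UNIV. y $ i * partial i u (x + r *\<^sub>R y)) * ?b y) (at r)" for r y
  proof -
    have "((\<lambda>r. x + r *\<^sub>R y) has_derivative (\<lambda>h. h *\<^sub>R y)) (at r)"
      by (auto intro!: derivative_eq_intros)
    from has_derivative_compose[OF this has_derivative_partials[OF smooth_differentiable[OF u]]]
    have "((\<lambda>r. u (x + r *\<^sub>R y)) has_derivative
        (\<lambda>h. h *\<^sub>R (\<Sum>i\<in>UNIV. y $ i * partial i u (x + r *\<^sub>R y)))) (at r)"
      by (simp add: sum_distrib_left mult.assoc)
    from has_derivative_mult_left[OF this, of "?b y"] show ?thesis
      by (simp add: has_vector_derivative_def mult.assoc)
  qed
  have "(?M has_vector_derivative ?M' r) (at r within UNIV)" for r
    by (rule leibniz_rule_vector_derivative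
        [where fx = "\<lambda>r y. (\<Sum>i\<in>UNIV. y $ i * partial i u (x + r *\<^sub>R y)) * ?b y"])
      (auto intro!: deriv integrable_continuous continuous_intros simp: split_beta)
  then have "(?M has_real_derivative 0) (at r)" for r
    unfolding M' by (simp add: has_real_derivative_iff_has_vector_derivative)
  \<comment> \<open>At radius 0 the integrand is \<open>u x * bump 2 y\<close>, so
    \<open>?M 0\<close> is the right-hand side.\<close>
  then have "?M r = ?M 0"
    using DERIV_isconst_all by blast
  then show ?thesis by simp
qed

text \<open>Integrating the mean value of a partial derivative by parts moves the derivative onto
  the weight. This bounds \<open>r\<close> times the derivative at \<open>x\<close> by a constant
  independent of \<open>r\<close>, so the derivative is zero.\<close>

lemma liouville_harmonic:
  fixes u :: "real^'n::finite \<Rightarrow> real"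
  assumes u: "smooth u" and harm: "\<And>x. (\<Sum>i\<in>UNIV. partial i (partial i u) x) = 0"
    and bdd: "bounded (range u)"
  shows "u x = u y"
proof -
  let ?b = "bump 2 :: real^'n \<Rightarrow> real"
  let ?C = "integral cube ?b"
  note [continuous_intros] =
    continuous_on_compose2[OF smooth_continuous_on[OF u, of UNIV]]
    continuous_on_compose2[OF smooth_continuous_on[OF smooth_partial[OF u], of UNIV]]
    continuous_on_compose2[OF continuous_on_bump[of UNIV]]
  obtain B where B: "\<And>x. \<bar>u x\<bar> \<le> B"
    using bdd by (auto simp: bounded_iff)
  \<comment> \<open>The constant is - 2 * 2. Exponent 2 is the least for which the gradient, a
    multiple of \<open>bump 1\<close>, is continuous.\<close>
  have db: "?b differentiable (at y)" "partial i ?b = (\<lambda>y. - 4 * (y $ i * bump 1 y))" for i y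
    using bump_derivative[where k = 0 and ?'n = 'n] by (simp_all add: numeral_eq_Suc fun_eq_iff mult.assoc)
  have grad: "partial i u x = 0" for i x
  proof -
    let ?e = "axis i 1 :: real^'n"
    \<comment> \<open>The mean value property of \<open>u\<close> is differentiated with respect to
      the centre, which gives that of \<open>partial i u\<close> for every radius.\<close>
    have mean': "?C * partial i u x = integral cube (\<lambda>y. partial i u (x + r *\<^sub>R y) * ?b y)" for r
    proof -
      have "((\<lambda>t. integral cube (\<lambda>y. u ((x + r *\<^sub>R y) + t *\<^sub>R ?e) * ?b y)) has_vector_derivative
          integral cube (\<lambda>y. partial i u ((x + r *\<^sub>R y) + 0 *\<^sub>R ?e) * ?b y)) (at 0 within UNIV)"
        by (rule leibniz_rule_vector_derivative
            [where fx = "\<lambda>t y. partial i u ((x + r *\<^sub>R y) + t *\<^sub>R ?e) * ?b y"])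
          (auto intro!: has_vector_derivative_mult_left has_vector_derivative_line
            smooth_differentiable[OF u] integrable_continuous continuous_intros simp: split_beta)
      moreover have "integral cube (\<lambda>y. u ((x + r *\<^sub>R y) + t *\<^sub>R ?e) * ?b y) = u (x + t *\<^sub>R ?e) * ?C" for t
        using harmonic_mean_value[OF u harm, of "x + t *\<^sub>R ?e" r] by (simp add: add_ac)
      ultimately have "((\<lambda>t. u (x + t *\<^sub>R ?e) * ?C) has_vector_derivative
          integral cube (\<lambda>y. partial i u (x + r *\<^sub>R y) * ?b y)) (at 0)"
        by simp
      moreover have "((\<lambda>t. u (x + t *\<^sub>R ?e) * ?C) has_vector_derivative
          partial i u (x + 0 *\<^sub>R ?e) * ?C) (at 0)"
        by (intro has_vector_derivative_mult_left has_vector_derivative_line smooth_differentiable[OF u])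
      ultimately have "integral cube (\<lambda>y. partial i u (x + r *\<^sub>R y) * ?b y) = partial i u (x + 0 *\<^sub>R ?e) * ?C"
        by (rule vector_derivative_unique_at)
      then show ?thesis by (simp add: mult.commute)
    qed
    have "bounded (partial i ?b ` cube)"
      unfolding db(2) by (intro compact_imp_bounded compact_continuous_image continuous_intros compact_cbox) auto
    then obtain E where E: "\<And>y. y \<in> cube \<Longrightarrow> \<bar>partial i ?b y\<bar> \<le> E"
      unfolding bounded_iff by fastforce
    have bound: "r * (?C * \<bar>partial i u x\<bar>) \<le> B * E * measure lborel (cube :: (real^'n) set)" if "r > 0" for r
    proof -
      have "r * (?C * \<bar>partial i u x\<bar>) = \<bar>r * (?C * partial i u x)\<bar>"
        using \<open>r > 0\<close> integral_bump_pos[of 2, where ?'n = 'n] by (simp add: abs_mult)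
      also have "r * (?C * partial i u x) = - integral cube (\<lambda>y. u (x + r *\<^sub>R y) * partial i ?b y)"
        unfolding mean'[of r]
        by (rule integral_by_parts[OF u db(1)]) (auto simp: db(2) bump_eq_0 intro!: continuous_intros)
      also have "\<bar>\<dots>\<bar> \<le> B * E * measure lborel (cube :: (real^'n) set)"
      proof -
        have nb: "norm (u (x + r *\<^sub>R y) * partial i ?b y) \<le> B * E" if "y \<in> cube" for y
          using mult_mono[OF B E[OF that]] B[of x] by (simp add: abs_mult)
        have int: "(\<lambda>y. u (x + r *\<^sub>R y) * partial i ?b y) integrable_on cube"
          unfolding db(2) by (auto intro!: integrable_continuous continuous_intros)
        have "0 \<le> B * E"
          using B[of x] E[of 0] by (simp add: mem_box_cart)
        from integrable_bound[OF this int nb] show ?thesis by simp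
      qed
      finally show ?thesis .
    qed
    have "?C * \<bar>partial i u x\<bar> = 0"
    proof (rule ccontr)
      let ?a = "?C * \<bar>partial i u x\<bar>" and ?R = "B * E * measure lborel (cube :: (real^'n) set)"
      assume "?a \<noteq> 0"
      with integral_bump_pos[of 2, where ?'n = 'n] have "?a > 0" by simp
      \<comment> \<open>This quotient is a radius large enough to violate
        \<open>bound\<close>.\<close>
      then have "(\<bar>?R\<bar> + 1) / ?a > 0" "(\<bar>?R\<bar> + 1) / ?a * ?a > ?R" by auto
      with bound show False by (meson not_less)
    qed
    then show ?thesis using integral_bump_pos[of 2, where ?'n = 'n] by simp
  qed
  have "(u has_derivative (\<lambda>h. 0)) (at x within UNIV)" for x
    using has_derivative_partials[OF smooth_differentiable[OF u]] by (simp add: grad)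
  then obtain c where "\<And>x. u x = c"
    using has_derivative_zero_constant[of UNIV u] by auto
  then show ?thesis by simp
qed

section \<open>The Poincare lemma\<close>

text \<open>The potential is the line integral of \<open>v\<close> along the segment from the origin
  to \<open>x\<close>.\<close>

lemma closed_imp_gradient:
  fixes v :: "real^'n::finite \<Rightarrow> real^'n"
  assumes v: "smooth v"
    and closed: "\<And>i j x. partial i (\<lambda>y. v y $ j) x = partial j (\<lambda>y. v y $ i) x"
  shows "\<exists>\<phi>. \<forall>x. GDERIV \<phi> x :> v x"
proof -
  note [continuous_intros] =
    continuous_on_compose2[OF smooth_continuous_on[OF v, of UNIV]]
    continuous_on_compose2[OF smooth_continuous_on[OF smooth_partial[OF v], of UNIV]]
  have sym: "partial i v x $ j = partial j v x $ i" for i j x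
    using closed[of i j x]
    by (simp add: partial_bounded_linear[OF bounded_linear_vec_nth smooth_differentiable[OF v]])
  \<comment> \<open>\<open>D x t\<close> has two roles: by closedness it is the gradient in
    \<open>x\<close> of the integrand of the potential, and without closedness it is the
    \<open>t\<close>-derivative of t v(t x). Its integral over the unit interval is therefore
    \<open>v x\<close>.\<close>
  define D where "D = (\<lambda>x t. v (t *\<^sub>R x) + t *\<^sub>R (\<Sum>i\<in>UNIV. x $ i *\<^sub>R partial i v (t *\<^sub>R x)))"
  have contD: "continuous_on S (\<lambda>(x, t). D x t)" for S
    unfolding D_def split_beta by (intro continuous_intros) auto
  have dx: "((\<lambda>x. v (t *\<^sub>R x) \<bullet> x) has_derivative blinfun_inner_left (D x t)) (at x)" for x t
  proof -
    have "((\<lambda>x. t *\<^sub>R x) has_derivative (\<lambda>h. t *\<^sub>R h)) (at x)"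
      by (auto intro!: derivative_eq_intros)
    from has_derivative_compose[OF this has_derivative_partials[OF smooth_differentiable[OF v]]]
    have "((\<lambda>x. v (t *\<^sub>R x)) has_derivative (\<lambda>h. \<Sum>i\<in>UNIV. (t *\<^sub>R h) $ i *\<^sub>R partial i v (t *\<^sub>R x))) (at x)" .
    from has_derivative_inner[OF this has_derivative_ident]
    have "((\<lambda>x. v (t *\<^sub>R x) \<bullet> x) has_derivative
        (\<lambda>h. v (t *\<^sub>R x) \<bullet> h + (\<Sum>i\<in>UNIV. (t *\<^sub>R h) $ i *\<^sub>R partial i v (t *\<^sub>R x)) \<bullet> x)) (at x)" .
    moreover have "(\<Sum>i\<in>UNIV. (t *\<^sub>R h) $ i *\<^sub>R partial i v (t *\<^sub>R x)) \<bullet> x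
        = t * (h \<bullet> (\<Sum>i\<in>UNIV. x $ i *\<^sub>R partial i v (t *\<^sub>R x)))" for h
    proof -
      have "(\<Sum>i\<in>UNIV. (t *\<^sub>R h) $ i *\<^sub>R partial i v (t *\<^sub>R x)) \<bullet> x
          = t * (\<Sum>i\<in>UNIV. \<Sum>j\<in>UNIV. h $ i * x $ j * partial i v (t *\<^sub>R x) $ j)"
        unfolding inner_vec_def
        by (simp add: sum_distrib_left sum_distrib_right mult_ac) (rule sum.swap)
      also have "\<dots> = t * (\<Sum>i\<in>UNIV. \<Sum>j\<in>UNIV. h $ i * x $ j * partial j v (t *\<^sub>R x) $ i)"
        by (subst sym) rule
      also have "\<dots> = t * (h \<bullet> (\<Sum>i\<in>UNIV. x $ i *\<^sub>R partial i v (t *\<^sub>R x)))"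
        by (simp add: inner_vec_def sum_distrib_left sum_distrib_right mult_ac)
      finally show ?thesis .
    qed
    ultimately show ?thesis
      by (simp add: D_def inner_add_right inner_commute)
  qed
  have dt: "((\<lambda>t. t *\<^sub>R v (t *\<^sub>R x)) has_vector_derivative D x t) (at t within S)" for x t S
  proof -
    have "((\<lambda>t. t *\<^sub>R x) has_derivative (\<lambda>h. h *\<^sub>R x)) (at t within S)"
      by (auto intro!: derivative_eq_intros)
    from has_derivative_compose[OF this has_derivative_partials[OF smooth_differentiable[OF v]]]
    have "((\<lambda>t. v (t *\<^sub>R x)) has_derivative (\<lambda>h. \<Sum>i\<in>UNIV. (h *\<^sub>R x) $ i *\<^sub>R partial i v (t *\<^sub>R x))) (at t within S)" .
    from has_derivative_scaleR[OF has_derivative_ident this]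
    show ?thesis
      by (simp add: has_vector_derivative_def D_def scaleR_sum_right scaleR_add_right mult_ac add_ac)
  qed
  define \<phi> where "\<phi> = (\<lambda>x. integral (cbox 0 1) (\<lambda>t. v (t *\<^sub>R x) \<bullet> x))"
  have "GDERIV \<phi> x :> v x" for x
  proof -
    have contDx: "continuous_on {0..1} (D x)"
      unfolding D_def by (intro continuous_intros) auto
    have "(D x has_integral 1 *\<^sub>R v (1 *\<^sub>R x) - 0 *\<^sub>R v (0 *\<^sub>R x)) {0..1}"
      by (rule fundamental_theorem_of_calculus) (auto intro: dt)
    then have ftc: "integral {0..1} (D x) = v x"
      by (simp add: integral_unique)
    have "(\<phi> has_derivative integral (cbox 0 1) (\<lambda>t. blinfun_inner_left (D x t))) (at x within UNIV)"
      unfolding \<phi>_def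
    proof (rule leibniz_rule)
      show "continuous_on (UNIV \<times> cbox 0 1) (\<lambda>(x, t). blinfun_inner_left (D x t))"
        using bounded_linear.continuous_on[OF bounded_linear_blinfun_inner_left contD]
        by (simp add: split_beta)
    qed (auto intro!: dx[simplified] integrable_continuous_interval continuous_intros)
    moreover have "integral (cbox 0 1) (\<lambda>t. blinfun_inner_left (D x t)) = blinfun_inner_left (v x)"
      using integral_linear[OF integrable_continuous_interval[OF contDx] bounded_linear_blinfun_inner_left]
      by (simp add: ftc o_def)
    ultimately show ?thesis by (simp add: gderiv_def blinfun_inner_left.rep_eq)
  qed
  then show ?thesis by blast
qed

section \<open>Curvature of flat-slice unit-lapse metrics\<close>

lemma has_derivative_spatial_part: "(spatial_part has_derivative spatial_part) (at p)"
proof (rule bounded_linear.has_derivative[OF _ has_derivative_ident])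
  have "linear spatial_part"
    by (rule linearI) (simp_all add: spatial_part_def vec_eq_iff)
  then show "bounded_linear spatial_part"
    by (simp add: linear_conv_bounded_linear)
qed

lemma partial_spatial:
  assumes "f differentiable (at (spatial_part p))"
  shows "partial (Some i) (\<lambda>q. f (spatial_part q)) p = partial i f (spatial_part p)"
    and "partial None (\<lambda>q. f (spatial_part q)) p = 0"
    and "(\<lambda>q. f (spatial_part q)) differentiable (at p)"
proof -
  from assms obtain D where D: "(f has_derivative D) (at (spatial_part p))"
    by (auto simp: differentiable_def)
  have E: "((\<lambda>q. f (spatial_part q)) has_derivative (\<lambda>h. D (spatial_part h))) (at p)"
    by (rule has_derivative_compose[OF has_derivative_spatial_part D])
  have s: "spatial_part (axis (Some i) 1) = axis i 1" "spatial_part (axis None 1) = 0"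
    by (simp_all add: spatial_part_def axis_def vec_eq_iff)
  show "partial (Some i) (\<lambda>q. f (spatial_part q)) p = partial i f (spatial_part p)"
    using partial_eqI[OF E] partial_eqI[OF D] by (simp add: s)
  show "partial None (\<lambda>q. f (spatial_part q)) p = 0"
    using partial_eqI[OF E] linear_0[OF has_derivative_linear[OF D]] by (simp add: s)
  show "(\<lambda>q. f (spatial_part q)) differentiable (at p)"
    using E by (auto simp: differentiable_def)
qed

text \<open>The function is constant along the time line through \<open>p\<close>. This form avoids
  exhibiting it as a composition with \<open>spatial_part\<close>.\<close>

lemma partial_None_eq_0:
  assumes "f differentiable (at p)" and "\<And>q. spatial_part q = spatial_part p \<Longrightarrow> f q = f p"
  shows "partial None f p = 0"
proof -
  have "spatial_part (p + t *\<^sub>R axis None 1) = spatial_part p" for t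
    by (simp add: spatial_part_def axis_def vec_eq_iff)
  then have "(\<lambda>t. f (p + t *\<^sub>R axis None 1)) = (\<lambda>t. f p)"
    using assms(2) by blast
  then have "((\<lambda>t. f p) has_vector_derivative partial None f p) (at (0::real))"
    using has_vector_derivative_line[of f p 0 None UNIV] assms(1) by simp
  then show ?thesis
    using vector_derivative_unique_at[OF has_vector_derivative_const[of "f p"]] by metis
qed

lemma inverse_metric_components:
  "inverse_metric (shift_metric \<beta>) p $ None $ None = - 1"
  "inverse_metric (shift_metric \<beta>) p $ None $ Some i = \<beta> (spatial_part p) $ i"
  "inverse_metric (shift_metric \<beta>) p $ Some i $ None = \<beta> (spatial_part p) $ i"
  "inverse_metric (shift_metric \<beta>) p $ Some i $ Some j =
     (if i = j then 1 else 0) - \<beta> (spatial_part p) $ i * \<beta> (spatial_part p) $ j"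
proof -
  let ?b = "\<beta> (spatial_part p)" and ?g = "shift_metric \<beta> p" and ?G = "inverse_metric (shift_metric \<beta>) p"
  \<comment> \<open>The Euclidean inverse metric on spatial indices minus the product of the normal
    (1, - \<beta>) with itself. It is checked as a right inverse; with the left inverse already
    known, uniqueness identifies the two.\<close>
  define h :: "real^(3 option)^(3 option)" where
    "h = (\<chi> a b. case a of
        None \<Rightarrow> (case b of None \<Rightarrow> - 1 | Some j \<Rightarrow> ?b $ j)
      | Some i \<Rightarrow> (case b of None \<Rightarrow> ?b $ i | Some j \<Rightarrow> (if i = j then 1 else 0) - ?b $ i * ?b $ j))"
  note [simp] = matrix_matrix_mult_def sum_option shift_metric_components mat_def
  have "(?g ** h) $ None $ None = (mat 1 :: real^(3 option)^(3 option)) $ None $ None"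
    by (simp add: h_def inner_vec_def)
  moreover have "(?g ** h) $ None $ Some j = (mat 1 :: real^(3 option)^(3 option)) $ None $ Some j" for j
    by (simp add: h_def right_diff_distrib mult_delta_right sum_subtractf inner_vec_def
        left_diff_distrib sum_distrib_right mult.assoc)
  moreover have "(?g ** h) $ Some i $ None = (mat 1 :: real^(3 option)^(3 option)) $ Some i $ None" for i
    by (simp add: h_def mult_delta_left)
  moreover have "(?g ** h) $ Some i $ Some j = (mat 1 :: real^(3 option)^(3 option)) $ Some i $ Some j" for i j
    by (simp add: h_def mult_delta_left)
  ultimately have "?g ** h = mat 1" by (simp only: vec_eq_iff split_option_all) blast
  then have "?G = h"
    by (metis inverse_metric_left matrix_mul_assoc matrix_mul_lid matrix_mul_rid)
  then show "?G $ None $ None = - 1" "?G $ None $ Some i = ?b $ i" "?G $ Some i $ None = ?b $ i"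
    "?G $ Some i $ Some j = (if i = j then 1 else 0) - ?b $ i * ?b $ j"
    by (simp_all add: h_def)
qed

definition jac :: "(real^'n::finite \<Rightarrow> real^'n) \<Rightarrow> 'n \<Rightarrow> 'n \<Rightarrow> real^'n \<Rightarrow> real" where
  "jac \<beta> i j x = partial i (\<lambda>y. \<beta> y $ j) x"

text \<open>For a shift on \<open>real^3\<close> this is minus the extrinsic curvature of the
  slice.\<close>

definition strain :: "(real^'n::finite \<Rightarrow> real^'n) \<Rightarrow> 'n \<Rightarrow> 'n \<Rightarrow> real^'n \<Rightarrow> real" where
  "strain \<beta> i j x = 1/2 * (jac \<beta> i j x + jac \<beta> j i x)"

text \<open>Half the exterior derivative of \<beta> viewed as a 1-form; as a tensor it makes sense
  in every dimension, unlike the curl.\<close>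

definition twist :: "(real^'n::finite \<Rightarrow> real^'n) \<Rightarrow> 'n \<Rightarrow> 'n \<Rightarrow> real^'n \<Rightarrow> real" where
  "twist \<beta> i j x = 1/2 * (jac \<beta> i j x - jac \<beta> j i x)"

lemma strain_commute: "strain \<beta> i j = strain \<beta> j i"
  by (simp add: strain_def fun_eq_iff)

lemma strain_plus_twist: "jac \<beta> i j x = strain \<beta> i j x + twist \<beta> i j x"
  by (simp add: strain_def twist_def algebra_simps)

lemma smooth_jac: "smooth \<beta> \<Longrightarrow> smooth (jac \<beta> i j)"
  unfolding jac_def[abs_def] by (intro smooth_partial smooth_component)

lemma smooth_strain: "smooth \<beta> \<Longrightarrow> smooth (strain \<beta> i j)"
  unfolding strain_def[abs_def] by (intro smooth_scale smooth_add smooth_jac)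

lemma smooth_twist: "smooth \<beta> \<Longrightarrow> smooth (twist \<beta> i j)"
  unfolding twist_def[abs_def] by (intro smooth_scale smooth_diff smooth_jac)

context
  fixes \<beta> :: "real^3 \<Rightarrow> real^3"
  assumes smooth: "smooth \<beta>"
begin

lemma differentiable_shift:
  "(\<lambda>x. \<beta> x $ i) differentiable (at x)" "jac \<beta> i j differentiable (at x)"
  "strain \<beta> i j differentiable (at x)" "twist \<beta> i j differentiable (at x)"
  using smooth
  by (intro smooth_differentiable smooth_component smooth_jac smooth_strain smooth_twist; assumption)+

lemma partial_shift_metric:
  "partial (Some k) (\<lambda>q. shift_metric \<beta> q $ None $ None) p
     = 2 * (\<Sum>l\<in>UNIV. \<beta> (spatial_part p) $ l * jac \<beta> k l (spatial_part p))"
  "partial (Some k) (\<lambda>q. shift_metric \<beta> q $ None $ Some i) p = jac \<beta> k i (spatial_part p)"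
  "partial (Some k) (\<lambda>q. shift_metric \<beta> q $ Some i $ None) p = jac \<beta> k i (spatial_part p)"
  "partial a (\<lambda>q. shift_metric \<beta> q $ Some i $ Some j) p = 0"
  "partial None (\<lambda>q. shift_metric \<beta> q $ b $ c) p = 0"
proof -
  let ?x = "spatial_part p"
  have d: "(\<lambda>x. \<Sum>l\<in>UNIV. \<beta> x $ l * \<beta> x $ l) differentiable (at x)" for x
    by (auto intro!: differentiable_sum differentiable_mult differentiable_shift)
  have dd: "(\<lambda>x. - 1 + (\<Sum>l\<in>UNIV. \<beta> x $ l * \<beta> x $ l)) differentiable (at x)" for x
    by (intro differentiable_add d) simp
  have "partial k (\<lambda>x. - 1 + (\<Sum>l\<in>UNIV. \<beta> x $ l * \<beta> x $ l)) ?x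
      = (\<Sum>l\<in>UNIV. partial k (\<lambda>x. \<beta> x $ l * \<beta> x $ l) ?x)"
    by (subst partial_add[OF _ d]) (simp_all add: partial_sum differentiable_mult differentiable_shift)
  then show "partial (Some k) (\<lambda>q. shift_metric \<beta> q $ None $ None) p
      = 2 * (\<Sum>l\<in>UNIV. \<beta> ?x $ l * jac \<beta> k l ?x)"
    using partial_spatial(1)[OF dd, of k p]
    by (simp add: shift_metric_components inner_vec_def partial_mult differentiable_shift
        jac_def sum_distrib_left mult_ac)
  show "partial (Some k) (\<lambda>q. shift_metric \<beta> q $ None $ Some i) p = jac \<beta> k i ?x"
    "partial (Some k) (\<lambda>q. shift_metric \<beta> q $ Some i $ None) p = jac \<beta> k i ?x"
    using partial_spatial(1)[OF differentiable_shift(1)]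
    by (simp_all add: shift_metric_components jac_def)
  show "partial a (\<lambda>q. shift_metric \<beta> q $ Some i $ Some j) p = 0"
    by (simp add: shift_metric_components)
  show "partial None (\<lambda>q. shift_metric \<beta> q $ b $ c) p = 0"
    using partial_spatial(2)[OF dd] partial_spatial(2)[OF differentiable_shift(1)]
    by (cases b; cases c) (simp_all add: shift_metric_components inner_vec_def)
qed

text \<open>With upper index \<open>None\<close> the symbol is minus the strain, each lower
  \<open>None\<close> being a contraction with \<beta>. Row \<open>Some i\<close> of the inverse
  metric is the Euclidean row minus \<open>\<beta> $ i\<close> times row \<open>None\<close>; so the
  symbols with upper index \<open>Some i\<close> repeat that pattern times
  \<open>- \<beta> $ i\<close>, plus the symbol lowered with the flat metric, which gives the twist
  and \<open>jac\<close> terms.\<close>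

lemma christoffel_shift_metric:
  "christoffel (shift_metric \<beta>) None None None = (\<lambda>p.
     - (\<Sum>k\<in>UNIV. \<Sum>l\<in>UNIV. \<beta> (spatial_part p) $ k * \<beta> (spatial_part p) $ l * strain \<beta> k l (spatial_part p)))"
  "christoffel (shift_metric \<beta>) None None (Some i) = (\<lambda>p.
     - (\<Sum>k\<in>UNIV. \<beta> (spatial_part p) $ k * strain \<beta> i k (spatial_part p)))"
  "christoffel (shift_metric \<beta>) None (Some i) None = (\<lambda>p.
     - (\<Sum>k\<in>UNIV. \<beta> (spatial_part p) $ k * strain \<beta> i k (spatial_part p)))"
  "christoffel (shift_metric \<beta>) None (Some i) (Some j) = (\<lambda>p. - strain \<beta> i j (spatial_part p))"
  "christoffel (shift_metric \<beta>) (Some i) (Some j) (Some k) = (\<lambda>p.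
     \<beta> (spatial_part p) $ i * strain \<beta> j k (spatial_part p))"
  "christoffel (shift_metric \<beta>) (Some i) None (Some j) = (\<lambda>p. twist \<beta> j i (spatial_part p)
     + \<beta> (spatial_part p) $ i * (\<Sum>k\<in>UNIV. \<beta> (spatial_part p) $ k * strain \<beta> j k (spatial_part p)))"
  "christoffel (shift_metric \<beta>) (Some i) (Some j) None = (\<lambda>p. twist \<beta> j i (spatial_part p)
     + \<beta> (spatial_part p) $ i * (\<Sum>k\<in>UNIV. \<beta> (spatial_part p) $ k * strain \<beta> j k (spatial_part p)))"
  "christoffel (shift_metric \<beta>) (Some i) None None = (\<lambda>p.
     - (\<Sum>k\<in>UNIV. \<beta> (spatial_part p) $ k * jac \<beta> i k (spatial_part p))
     + \<beta> (spatial_part p) $ i * (\<Sum>k\<in>UNIV. \<Sum>l\<in>UNIV.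
         \<beta> (spatial_part p) $ k * \<beta> (spatial_part p) $ l * strain \<beta> k l (spatial_part p)))"
  by (rule ext; simp add: christoffel_def sum_option inverse_metric_components partial_shift_metric
      left_diff_distrib sum_subtractf mult_delta_left;
      simp add: strain_def twist_def sum_3; simp add: field_simps)+

lemma christoffel_trace:
  "(\<Sum>a\<in>UNIV. christoffel (shift_metric \<beta>) a a b p) = 0"
  by (cases b) (simp_all add: sum_option christoffel_shift_metric sum.distrib sum_distrib_left
      twist_def strain_commute mult_ac)

lemma differentiable_christoffel: "christoffel (shift_metric \<beta>) a b c differentiable (at p)"
  by (cases a; cases b; cases c)
    (auto simp: christoffel_shift_metric intro!: differentiable_add differentiable_diff differentiable_minus differentiable_mult
      differentiable_sum partial_spatial(3) differentiable_shift)

text \<open>\<open>det g = - 1\<close>, so the contracted Christoffel symbols vanish and only two of the four terms survive.\<close>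

lemma ricci_shift_metric:
  "ricci (shift_metric \<beta>) p $ b $ d =
     (\<Sum>k\<in>UNIV. partial (Some k) (christoffel (shift_metric \<beta>) (Some k) d b) p)
     - (\<Sum>a\<in>UNIV. \<Sum>e\<in>UNIV. christoffel (shift_metric \<beta>) a d e p * christoffel (shift_metric \<beta>) e a b p)"
proof -
  let ?C = "christoffel (shift_metric \<beta>)"
  have "(\<Sum>a\<in>UNIV. partial d (?C a a b) p) = partial d (\<lambda>q. \<Sum>a\<in>UNIV. ?C a a b q) p"
    by (rule partial_sum[symmetric]) (rule differentiable_christoffel)
  then have t1: "(\<Sum>a\<in>UNIV. partial d (?C a a b) p) = 0"
    by (simp add: christoffel_trace)
  have "(\<Sum>a\<in>UNIV. \<Sum>e\<in>UNIV. ?C a a e p * ?C e d b p) = (\<Sum>e\<in>UNIV. (\<Sum>a\<in>UNIV. ?C a a e p) * ?C e d b p)"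
    unfolding sum_distrib_right by (rule sum.swap)
  then have t2: "(\<Sum>a\<in>UNIV. \<Sum>e\<in>UNIV. ?C a a e p * ?C e d b p) = 0"
    by (simp add: christoffel_trace)
  have t3: "partial None (?C None d b) p = 0"
    by (rule partial_None_eq_0[OF differentiable_christoffel])
      (cases d; cases b; simp add: christoffel_shift_metric)
  have "ricci (shift_metric \<beta>) p $ b $ d = (\<Sum>a\<in>UNIV. partial a (?C a d b) p)
      - (\<Sum>a\<in>UNIV. partial d (?C a a b) p) + (\<Sum>a\<in>UNIV. \<Sum>e\<in>UNIV. ?C a a e p * ?C e d b p)
      - (\<Sum>a\<in>UNIV. \<Sum>e\<in>UNIV. ?C a d e p * ?C e a b p)"
    by (simp add: ricci_def riemann_def sum.distrib sum_subtractf)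
  moreover have "(\<Sum>a\<in>UNIV. partial a (?C a d b) p) = (\<Sum>k\<in>UNIV. partial (Some k) (?C (Some k) d b) p)"
    by (simp only: sum_option t3 add_0)
  ultimately show ?thesis by (simp only: t1 t2 diff_0_right add_0_right)
qed

text \<open>The symbols with upper index \<open>None\<close> are the covariant derivative of the
  lowered normal \<open>- dt\<close>, and contracting that with the normal gives zero since the
  normal has constant length. This removes most products in the Ricci tensor.\<close>

lemma christoffel_normal:
  "(\<Sum>d\<in>UNIV. christoffel (shift_metric \<beta>) None d e p * normal \<beta> p $ d) = 0"
  "(\<Sum>d\<in>UNIV. christoffel (shift_metric \<beta>) (Some l) d None p * normal \<beta> p $ d)
     = - (\<Sum>k\<in>UNIV. \<beta> (spatial_part p) $ k * strain \<beta> k l (spatial_part p))"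
  "(\<Sum>d\<in>UNIV. christoffel (shift_metric \<beta>) (Some l) d (Some k) p * normal \<beta> p $ d)
     = twist \<beta> k l (spatial_part p)"
proof -
  show "(\<Sum>d\<in>UNIV. christoffel (shift_metric \<beta>) None d e p * normal \<beta> p $ d) = 0"
    by (cases e)
      (simp_all add: sum_option christoffel_shift_metric normal_components sum_distrib_left sum_distrib_right
        sum_negf mult_ac strain_commute)
qed (simp_all add: sum_option christoffel_shift_metric normal_components sum_3 strain_def twist_def field_simps)

text \<open>This is the Codazzi equation: on a flat slice, the divergence of the extrinsic curvature
  minus the gradient of its trace equals the divergence of the twist, because mixed partials
  commute. Here it is computed directly from the Christoffel symbols.\<close>

lemma ricci_normal:
  "(\<Sum>d\<in>UNIV. ricci (shift_metric \<beta>) p $ Some i $ d * normal \<beta> p $ d)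
     = (\<Sum>k\<in>UNIV. partial k (twist \<beta> i k) (spatial_part p))"
proof -
  let ?C = "christoffel (shift_metric \<beta>)" and ?x = "spatial_part p" and ?n = "normal \<beta> p"
  have d2: "(\<lambda>x. \<Sum>l\<in>UNIV. \<beta> x $ l * strain \<beta> i l x) differentiable (at x)" for x i
    by (auto intro!: differentiable_sum differentiable_mult differentiable_shift)
  have d3: "(\<lambda>x. \<beta> x $ k * (\<Sum>l\<in>UNIV. \<beta> x $ l * strain \<beta> i l x)) differentiable (at x)" for x i k
    by (intro differentiable_mult differentiable_shift d2)
  have d4: "(\<lambda>x. twist \<beta> i k x + \<beta> x $ k * (\<Sum>l\<in>UNIV. \<beta> x $ l * strain \<beta> i l x)) differentiable (at x)" for x i k
    by (intro differentiable_add differentiable_shift d3)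
  have d5: "(\<lambda>x. \<beta> x $ k * strain \<beta> i l x) differentiable (at x)" for x i k l
    by (intro differentiable_mult differentiable_shift)
  have p0: "partial (Some k) (?C (Some k) None (Some i)) p = partial k (twist \<beta> i k) ?x
      + \<beta> ?x $ k * (\<Sum>l\<in>UNIV. \<beta> ?x $ l * partial k (strain \<beta> i l) ?x + jac \<beta> k l ?x * strain \<beta> i l ?x)
      + jac \<beta> k k ?x * (\<Sum>l\<in>UNIV. \<beta> ?x $ l * strain \<beta> i l ?x)" for k
    unfolding christoffel_shift_metric partial_spatial(1)[OF d4]
    by (simp add: partial_add[OF differentiable_shift(4) d3] partial_mult[OF differentiable_shift(1) d2]
        partial_sum[OF d5] partial_mult[OF differentiable_shift(1) differentiable_shift(3)] jac_def)
  have p1: "partial (Some k) (?C (Some k) (Some j) (Some i)) p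
      = \<beta> ?x $ k * partial k (strain \<beta> i j) ?x + jac \<beta> k k ?x * strain \<beta> i j ?x" for k j
    unfolding christoffel_shift_metric partial_spatial(1)[OF d5]
    by (simp add: partial_mult[OF differentiable_shift(1) differentiable_shift(3)] jac_def strain_commute[of _ j i])
  \<comment> \<open>Strain and twist recombine into \<open>jac\<close>. The result is exactly the
    term in \<open>p0\<close> that comes from differentiating \<beta> inside the inner sum; the
    other undesired terms of \<open>p0\<close> cancel against \<open>p1\<close> contracted with the
    normal.\<close>
  have quad: "(\<Sum>d\<in>UNIV. (\<Sum>a\<in>UNIV. \<Sum>e\<in>UNIV. ?C a d e p * ?C e a (Some i) p) * ?n $ d)
      = (\<Sum>l\<in>UNIV. \<Sum>k\<in>UNIV. \<beta> ?x $ k * jac \<beta> k l ?x * strain \<beta> i l ?x)"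
  proof -
    have "(\<Sum>d\<in>UNIV. (\<Sum>a\<in>UNIV. \<Sum>e\<in>UNIV. ?C a d e p * ?C e a (Some i) p) * ?n $ d)
        = (\<Sum>d\<in>UNIV. \<Sum>a\<in>UNIV. \<Sum>e\<in>UNIV. ?C a d e p * ?n $ d * ?C e a (Some i) p)"
      by (simp add: sum_distrib_right sum_distrib_left mult_ac)
    also have "\<dots> = (\<Sum>a\<in>UNIV. \<Sum>e\<in>UNIV. \<Sum>d\<in>UNIV. ?C a d e p * ?n $ d * ?C e a (Some i) p)"
      by (subst sum.swap, rule sum.cong[OF refl], rule sum.swap)
    also have "\<dots> = (\<Sum>a\<in>UNIV. \<Sum>e\<in>UNIV. (\<Sum>d\<in>UNIV. ?C a d e p * ?n $ d) * ?C e a (Some i) p)"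
      by (simp only: sum_distrib_right)
    also have "\<dots> = (\<Sum>l\<in>UNIV. (\<Sum>k\<in>UNIV. \<beta> ?x $ k * strain \<beta> k l ?x) * strain \<beta> l i ?x
        + (\<Sum>k\<in>UNIV. twist \<beta> k l ?x * (\<beta> ?x $ k * strain \<beta> l i ?x)))"
    proof -
      define N where "N = (\<lambda>a e. \<Sum>d\<in>UNIV. ?C a d e p * ?n $ d)"
      have N: "N None e = 0" "N (Some l) None = - (\<Sum>k\<in>UNIV. \<beta> ?x $ k * strain \<beta> k l ?x)"
        "N (Some l) (Some k) = twist \<beta> k l ?x" for e k l
        by (simp_all add: N_def christoffel_normal)
      have "(\<Sum>a\<in>UNIV. \<Sum>e\<in>UNIV. N a e * ?C e a (Some i) p) = (\<Sum>l\<in>UNIV.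
          (\<Sum>k\<in>UNIV. \<beta> ?x $ k * strain \<beta> k l ?x) * strain \<beta> l i ?x
          + (\<Sum>k\<in>UNIV. twist \<beta> k l ?x * (\<beta> ?x $ k * strain \<beta> l i ?x)))"
        by (simp add: sum_option N christoffel_shift_metric)
      then show ?thesis by (simp only: N_def)
    qed
    also have "\<dots> = (\<Sum>l\<in>UNIV. \<Sum>k\<in>UNIV. \<beta> ?x $ k * jac \<beta> k l ?x * strain \<beta> i l ?x)"
      by (simp add: strain_plus_twist sum_distrib_left sum_distrib_right sum.distrib algebra_simps
          strain_commute[of _ i])
    finally show ?thesis .
  qed
  have "(\<Sum>d\<in>UNIV. ricci (shift_metric \<beta>) p $ Some i $ d * ?n $ d)
      = (\<Sum>d\<in>UNIV. (\<Sum>k\<in>UNIV. partial (Some k) (?C (Some k) d (Some i)) p) * ?n $ d)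
        - (\<Sum>d\<in>UNIV. (\<Sum>a\<in>UNIV. \<Sum>e\<in>UNIV. ?C a d e p * ?C e a (Some i) p) * ?n $ d)"
    by (simp add: ricci_shift_metric left_diff_distrib sum_subtractf)
  also have "\<dots> = (\<Sum>k\<in>UNIV. partial k (twist \<beta> i k) ?x)"
    unfolding quad by (simp add: sum_option normal_components p0 p1 sum_3) (simp add: algebra_simps)
  finally show ?thesis .
qed

lemma momentum_density_eq:
  "momentum_density \<beta> p $ i = - (1 / (8 * pi)) * (\<Sum>k\<in>UNIV. partial k (twist \<beta> i k) (spatial_part p))"
proof -
  let ?x = "spatial_part p" and ?n = "normal \<beta> p" and ?G = "einstein (shift_metric \<beta>) p"
    and ?I = "inverse_metric (shift_metric \<beta>) p"
  have proj: "projection \<beta> p $ Some i $ None = \<beta> ?x $ i"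
    "projection \<beta> p $ Some i $ Some j = (if i = j then 1 else 0)" for j
    by (simp_all add: projection_def normal_components normal_lowered_eq dt_def axis_def)
  \<comment> \<open>The projected inverse metric is purely spatial and Euclidean, so projecting and
    raising leaves the plain covariant component \<open>Some i\<close>.\<close>
  have raise: "(\<Sum>a\<in>UNIV. projection \<beta> p $ Some i $ a * (\<Sum>c\<in>UNIV. ?I $ a $ c * f c)) = f (Some i)" for f
    using exhaust_3[of i] by (auto simp: sum_option proj inverse_metric_components sum_3 algebra_simps)
  \<comment> \<open>The spatial components of the lowered normal \<open>- dt\<close> vanish, which
    eliminates the scalar curvature.\<close>
  have low: "(\<Sum>b\<in>UNIV. shift_metric \<beta> p $ Some i $ b * ?n $ b) = 0"
    using exhaust_3[of i] by (auto simp: sum_option shift_metric_components normal_components sum_3)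
  have "momentum_density \<beta> p $ i = - (\<Sum>b\<in>UNIV. \<Sum>a\<in>UNIV.
      projection \<beta> p $ Some i $ a * stress_energy_mixed (shift_metric \<beta>) p $ a $ b * ?n $ b)"
    unfolding momentum_density_def by (simp only: vec_lambda_beta) (subst sum.swap, rule refl)
  also have "\<dots> = - (\<Sum>b\<in>UNIV. stress_energy (shift_metric \<beta>) p $ Some i $ b * ?n $ b)"
    by (simp add: stress_energy_mixed_def raise sum_distrib_right[symmetric])
  also have "\<dots> = - (1 / (8 * pi)) * (\<Sum>b\<in>UNIV. ?G $ Some i $ b * ?n $ b)"
    by (simp add: stress_energy_def sum_distrib_left mult_ac sum_negf)
  also have "(\<Sum>b\<in>UNIV. ?G $ Some i $ b * ?n $ b)
      = (\<Sum>b\<in>UNIV. ricci (shift_metric \<beta>) p $ Some i $ b * ?n $ b)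
        - 1/2 * scalar_curvature (shift_metric \<beta>) p * (\<Sum>b\<in>UNIV. shift_metric \<beta> p $ Some i $ b * ?n $ b)"
    by (simp add: einstein_def left_diff_distrib right_diff_distrib sum_subtractf sum_distrib_left mult_ac)
  finally show ?thesis by (simp add: low ricci_normal)
qed

text \<open>This is the situation of a rotating frame: only the Coriolis symbols (constant) and the
  centrifugal ones (linear in \<beta>) survive.\<close>

lemma einstein_eq_0_if_rigid:
  assumes strain: "\<And>i j x. strain \<beta> i j x = 0" and const: "\<And>i j x y. jac \<beta> i j x = jac \<beta> i j y"
  shows "einstein (shift_metric \<beta>) p = 0"
proof -
  let ?C = "christoffel (shift_metric \<beta>)" and ?x = "spatial_part p"
  define c where "c i j = jac \<beta> i j ?x" for i j
  have jac: "jac \<beta> i j = (\<lambda>x. c i j)" for i j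
    unfolding c_def by (rule ext) (rule const)
  have twist: "twist \<beta> i j = (\<lambda>x. c i j)" for i j
    using strain_plus_twist[of \<beta> i j] by (simp add: strain jac fun_eq_iff)
  have C: "?C None b c = (\<lambda>p. 0)" "?C (Some i) (Some j) (Some k) = (\<lambda>p. 0)" for b c i j k
    by (cases b; cases c; simp add: christoffel_shift_metric strain)+
  have C': "?C (Some i) None (Some j) = (\<lambda>p. c j i)" "?C (Some i) (Some j) None = (\<lambda>p. c j i)"
    "?C (Some i) None None = (\<lambda>p. - (\<Sum>k\<in>UNIV. \<beta> (spatial_part p) $ k * c i k))" for i j
    by (simp_all add: christoffel_shift_metric strain twist jac)
  have d: "(\<lambda>x. \<beta> x $ k * r) differentiable (at x)" for k x r
    by (intro differentiable_mult differentiable_shift) simp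
  have p00: "partial (Some l) (?C (Some i) None None) p = - (\<Sum>k\<in>UNIV. c l k * c i k)" for i l
  proof -
    have "(\<lambda>x. - (\<Sum>k\<in>UNIV. \<beta> x $ k * c i k)) differentiable (at ?x)"
      by (auto intro!: differentiable_minus differentiable_sum d)
    from partial_spatial(1)[OF this, of l]
    have "partial (Some l) (?C (Some i) None None) p = partial l (\<lambda>x. - (\<Sum>k\<in>UNIV. \<beta> x $ k * c i k)) ?x"
      unfolding C' .
    also have "\<dots> = - (\<Sum>k\<in>UNIV. jac \<beta> l k ?x * c i k)"
      by (simp add: partial_minus[OF differentiable_sum] d partial_sum partial_mult differentiable_shift jac_def)
    finally show ?thesis by (simp add: jac)
  qed
  \<comment> \<open>Antisymmetry decides the time-time component: the divergence of the centrifugal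
    symbol, minus the sum of squares of \<open>c\<close>, cancels the product of two Coriolis
    symbols.\<close>
  have anti: "c i j * c j i = - (c j i * c j i)" for i j
  proof -
    have "c i j = - c j i" using strain[of i j ?x] by (simp add: strain_def jac)
    then show ?thesis by simp
  qed
  have "ricci (shift_metric \<beta>) p $ b $ d = 0" for b d
    unfolding ricci_shift_metric
    by (cases b; cases d) (simp_all add: sum_option C, simp_all add: C' p00[unfolded C'] anti sum_negf)
  then have "ricci (shift_metric \<beta>) p = 0" by (simp add: vec_eq_iff)
  then show ?thesis by (simp add: einstein_def scalar_curvature_def)
qed

end

section \<open>Vanishing momentum density\<close>

text \<open>Every point of space is the spatial part of some event, so quantifying over events or
  over points is the same.\<close>

lemma momentum_density_eq_0_iff:
  assumes "smooth \<beta>"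
  shows "(\<forall>p. momentum_density \<beta> p = 0) \<longleftrightarrow> (\<forall>i x. (\<Sum>k\<in>UNIV. partial k (twist \<beta> i k) x) = 0)"
proof -
  have "spatial_part (\<chi> a. case a of None \<Rightarrow> 0 | Some i \<Rightarrow> x $ i) = x" for x
    by (simp add: spatial_part_def vec_eq_iff)
  then have "surj spatial_part" by (rule surjI)
  then have "(\<forall>p. P (spatial_part p)) \<longleftrightarrow> (\<forall>x. P x)" for P by (metis surjD)
  from this[of "\<lambda>x. \<forall>i. (\<Sum>k\<in>UNIV. partial k (twist \<beta> i k) x) = 0"] show ?thesis
    by (auto simp: vec_eq_iff momentum_density_eq[OF assms])
qed

lemma partial_twist:
  assumes "smooth \<beta>"
  shows "partial k (twist \<beta> i j) x = 1/2 * (partial k (jac \<beta> i j) x - partial k (jac \<beta> j i) x)"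
proof -
  note d = smooth_differentiable[OF smooth_jac[OF assms]]
  show ?thesis
    unfolding twist_def[abs_def] partial_bounded_linear[OF bounded_linear_mult_right differentiable_diff[OF d d]]
    by (simp add: partial_diff[OF d d])
qed

text \<open>The twist is a closed 2-form, so its Laplacian is the exterior derivative of its divergence.\<close>

lemma twist_harmonic:
  assumes \<beta>: "smooth \<beta>" and div: "\<And>i x. (\<Sum>k\<in>UNIV. partial k (twist \<beta> i k) x) = 0"
  shows "(\<Sum>k\<in>UNIV. partial k (partial k (twist \<beta> i j)) x) = 0"
proof -
  let ?T = "twist \<beta>"
  have d: "partial k (?T i j) differentiable (at x)" for i j k x
    by (intro smooth_differentiable smooth_partial smooth_twist \<beta>)
  have "partial k (jac \<beta> i j) x = partial i (jac \<beta> k j) x" for i j k x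
    unfolding jac_def[abs_def] by (intro partial_commute smooth_component \<beta>)
  \<comment> \<open>The cyclic identity of a closed 2-form, rearranged by antisymmetry so that
    \<open>k\<close> becomes the second index on the right, where \<open>div\<close>
    applies.\<close>
  then have closed: "partial k (?T i j) = (\<lambda>x. partial j (?T i k) x - partial i (?T j k) x)" for i j k
    by (simp add: partial_twist[OF \<beta>] fun_eq_iff algebra_simps)
  have "(\<Sum>k\<in>UNIV. partial k (partial i (?T j k)) x) = 0" for i j
  proof -
    have "(\<Sum>k\<in>UNIV. partial k (partial i (?T j k)) x) = (\<Sum>k\<in>UNIV. partial i (partial k (?T j k)) x)"
      by (intro sum.cong refl partial_commute smooth_twist \<beta>)
    also have "\<dots> = partial i (\<lambda>x. \<Sum>k\<in>UNIV. partial k (?T j k) x) x"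
      by (rule partial_sum[symmetric]) (rule d)
    finally show ?thesis by (simp add: div)
  qed
  moreover have "partial k (partial k (?T i j)) x = partial k (partial j (?T i k)) x - partial k (partial i (?T j k)) x" for k
    by (subst closed) (rule partial_diff[OF d d])
  ultimately show ?thesis by (simp add: sum_subtractf)
qed

lemma curl_components:
  "curl \<beta> x $ 1 = 2 * twist \<beta> 2 3 x" "curl \<beta> x $ 2 = 2 * twist \<beta> 3 1 x" "curl \<beta> x $ 3 = 2 * twist \<beta> 1 2 x"
  by (simp_all add: curl_def twist_def jac_def)

lemma bounded_twist:
  assumes "bounded (range (curl \<beta>))"
  shows "bounded (range (twist \<beta> i j))"
proof -
  have "\<bar>twist \<beta> i j x\<bar> \<le> norm (curl \<beta> x)" for x
    using exhaust_3[of i] exhaust_3[of j] component_le_norm_cart[of "curl \<beta> x" 1]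
      component_le_norm_cart[of "curl \<beta> x" 2] component_le_norm_cart[of "curl \<beta> x" 3]
    by (auto simp: curl_components) (auto simp: twist_def)
  moreover obtain B where "\<And>x. norm (curl \<beta> x) \<le> B"
    using assms by (auto simp: bounded_iff)
  ultimately have "\<bar>twist \<beta> i j x\<bar> \<le> B" for x by (meson order_trans)
  then show ?thesis by (auto simp: bounded_iff)
qed

section \<open>Rotations and gradients as shifts\<close>

lemma bounded_linear_cross3: "bounded_linear (cross3 \<Omega>)"
proof -
  have "linear (cross3 \<Omega>)"
    by (rule linearI) (simp_all add: cross_add_right cross_mult_right)
  then show ?thesis by (simp add: linear_conv_bounded_linear)
qed

lemma jac_cross3: "jac (cross3 \<Omega>) i j x = cross3 \<Omega> (axis i 1) $ j"
  unfolding jac_def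
  by (rule partial_eqI bounded_linear.has_derivative[OF bounded_linear_vec_nth]
      bounded_linear.has_derivative[OF bounded_linear_cross3] has_derivative_ident)+

lemma strain_cross3: "strain (cross3 \<Omega>) i j x = 0"
  using exhaust_3[of i] exhaust_3[of j] by (auto simp: strain_def jac_cross3 cross3_def axis_def)

lemma twist_cross3: "twist (cross3 \<Omega>) i j x = cross3 \<Omega> (axis i 1) $ j"
  using strain_plus_twist[of "cross3 \<Omega>" i j x] by (simp add: strain_cross3 jac_cross3)

lemma twist_diff:
  assumes "smooth \<beta>" "smooth \<gamma>"
  shows "twist (\<lambda>x. \<beta> x - \<gamma> x) i j x = twist \<beta> i j x - twist \<gamma> i j x"
  using smooth_differentiable[OF smooth_component[OF assms(1)]] smooth_differentiable[OF smooth_component[OF assms(2)]]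
  by (simp add: twist_def jac_def partial_diff algebra_simps)

text \<open>No smoothness of the potential is assumed: its partial derivatives are the components of
  the smooth field \<open>v\<close>, so \<open>smooth_iff\<close> provides it and second partials
  commute.\<close>

lemma twist_gradient:
  assumes "smooth v" "\<And>x. GDERIV \<phi> x :> v x"
  shows "twist v i j x = 0"
proof -
  have d: "(\<phi> has_derivative (\<lambda>h. h \<bullet> v x)) (at x)" for x
    using assms(2) by (simp add: gderiv_def)
  have p: "partial i \<phi> = (\<lambda>x. v x $ i)" for i
    using partial_eqI[OF d] by (auto simp: inner_axis')
  have "smooth \<phi>"
    using d assms(1) by (subst smooth_iff) (auto simp: p differentiable_def intro: smooth_component)
  then show ?thesis
    using partial_commute[of \<phi> i j x] by (simp add: twist_def jac_def p)
qed

theorem lemma2: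
  fixes \<beta> :: "real^3 \<Rightarrow> real^3"
  assumes "smooth \<beta>"
    and "bounded (range (curl \<beta>))"
  shows "((\<forall>p. momentum_density \<beta> p = 0) \<longleftrightarrow>
      (\<exists>(\<phi> :: real^3 \<Rightarrow> real) (grad_\<phi> :: real^3 \<Rightarrow> real^3) (\<Omega> :: real^3).
         (\<forall>x. GDERIV \<phi> x :> grad_\<phi> x) \<and> (\<forall>x. \<beta> x = grad_\<phi> x + cross3 \<Omega> x)))
    \<and> (\<forall>\<Omega> :: real^3.
         (\<forall>x. extrinsic_curvature (\<lambda>y. cross3 \<Omega> y) x = 0) \<and>
         (\<forall>p. einstein (shift_metric (\<lambda>y. cross3 \<Omega> y)) p = 0))"
proof (intro conjI allI iffI)
  have rot: "smooth (cross3 \<Omega>)" for \<Omega>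
    by (rule smooth_bounded_linear[OF bounded_linear_cross3])
  have twist_rot: "twist (\<lambda>x. \<beta> x - cross3 \<Omega> x) i j x = twist \<beta> i j x - cross3 \<Omega> (axis i 1) $ j" for \<Omega> i j x
    by (simp add: twist_diff[OF assms(1) rot] twist_cross3)
  {
    assume "\<forall>p. momentum_density \<beta> p = 0"
    then have "(\<Sum>k\<in>UNIV. partial k (twist \<beta> i k) x) = 0" for i x
      by (simp add: momentum_density_eq_0_iff[OF assms(1)])
    then have const: "twist \<beta> i j x = twist \<beta> i j 0" for i j x
      by (intro liouville_harmonic smooth_twist twist_harmonic bounded_twist assms)
    \<comment> \<open>The curl of a rotation field with angular velocity \<Omega> is twice \<Omega>,
      hence the half; any base point would serve, as the twist is constant.\<close>
    define \<Omega> where "\<Omega> = (1/2) *\<^sub>R curl \<beta> 0"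
    define v where "v = (\<lambda>x. \<beta> x - cross3 \<Omega> x)"
    have "twist \<beta> i j 0 = cross3 \<Omega> (axis i 1) $ j" for i j
      using exhaust_3[of i] exhaust_3[of j]
      by (auto simp: \<Omega>_def cross3_def axis_def curl_components) (simp_all add: twist_def field_simps)
    then have "twist v i j x = 0" for i j x
      unfolding v_def twist_rot by (subst const) simp
    then have "partial i (\<lambda>y. v y $ j) x = partial j (\<lambda>y. v y $ i) x" for i j x
      by (simp add: twist_def jac_def)
    moreover have "smooth v"
      unfolding v_def by (intro smooth_diff assms rot)
    ultimately obtain \<phi> where "\<forall>x. GDERIV \<phi> x :> v x"
      using closed_imp_gradient by blast
    then show "\<exists>\<phi> grad_\<phi> \<Omega>. (\<forall>x. GDERIV \<phi> x :> grad_\<phi> x) \<and> (\<forall>x. \<beta> x = grad_\<phi> x + cross3 \<Omega> x)"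
      by (intro exI[of _ \<phi>] exI[of _ v] exI[of _ \<Omega>]) (simp add: v_def)
  }
  {
    fix p
    assume "\<exists>\<phi> grad_\<phi> \<Omega>. (\<forall>x. GDERIV \<phi> x :> grad_\<phi> x) \<and> (\<forall>x. \<beta> x = grad_\<phi> x + cross3 \<Omega> x)"
    then obtain \<phi> grad_\<phi> \<Omega> where grad: "\<And>x. GDERIV \<phi> x :> grad_\<phi> x"
      and \<beta>: "\<And>x. \<beta> x = grad_\<phi> x + cross3 \<Omega> x" by blast
    \<comment> \<open>The gradient is not assumed smooth; as the difference of \<beta> and a linear
      field it is.\<close>
    have "grad_\<phi> = (\<lambda>x. \<beta> x - cross3 \<Omega> x)" using \<beta> by simp
    then have "twist (\<lambda>x. \<beta> x - cross3 \<Omega> x) i j x = 0" for i j x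
      using grad by (intro twist_gradient smooth_diff assms rot) simp
    then have "twist \<beta> i j = (\<lambda>x. cross3 \<Omega> (axis i 1) $ j)" for i j
      by (simp add: twist_rot fun_eq_iff)
    then show "momentum_density \<beta> p = 0"
      using momentum_density_eq_0_iff[OF assms(1)] by simp
  }
  show "extrinsic_curvature (\<lambda>y. cross3 \<Omega> y) x = 0" for \<Omega> x
    using strain_cross3[of \<Omega>]
    by (simp add: extrinsic_curvature_def vec_eq_iff strain_def jac_def)
  show "einstein (shift_metric (\<lambda>y. cross3 \<Omega> y)) p = 0" for \<Omega> p
    by (rule einstein_eq_0_if_rigid[OF rot strain_cross3]) (simp add: jac_cross3)
qed

end
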